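(* Let $\mathcal A_0,\ldots,\mathcal A_n\subset\mathbb Z^n$ be an essential family of finite sets of integral vectors, and let $\mathrm{Res}_{\mathcal A_0,\ldots,\mathcal A_n}\in\mathbb Z[X_0,\ldots,X_n]$ be the associated mixed sparse resultant. Then \[m(\mathrm{Res}_{\mathcal A_0,\ldots,\mathcal A_n})=0 \iff \dim N(\mathrm{Res}_{\mathcal A_0,\ldots,\mathcal A_n})=1,\] where $N(\cdot)$ denotes the Newton polytope.
   Context: For $i=0,\ldots,n$ write $\mathcal A_i=\{a_{ij}\}_{j=1,\ldots,k_i}\subset\mathbb Z^n$, and let $X_i=\{x_{ij}:1\le j\le k_i\}$ be groups of indeterminates, $k=k_0+\cdots+k_n$. Consider the generic system of Laurent polynomials $F_i(t_1,\ldots,t_n)=\sum_{j=1}^{k_i}x_{ij}\mathbf t^{a_{ij}}$, $i=0,\ldots,n$, where $\mathbf t^{a}=t_1^{a_1}\cdots t_n^{a_n}$. The mixed sparse resultant $\mathrm{Res}_{\mathcal A_0,\ldots,\mathcal A_n}$ is the (up to sign unique) irreducible primitive polynomial in $\mathbb Z[X_0,\ldots,X_n]$ that vanishes at a specialization of the coefficients (in an algebraically closed field $K$) whenever the specialized system has a common zero in $(K\setminus\{0\})^n$ (in the sense of Gelfand–Kapranov–Zelevinsky/Sturmfels). The family is essential when this resultant has positive degree (in the sense of Sturmfels, i.e. the variety of systems with a common toric zero is a hypersurface). The Mahler measure of $g\in\mathbb C[y_1,\ldots,y_k]$ is $m(g)=\frac{1}{(2\pi i)^k}\int_{\mathbb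 T^k}\log|g(y_1,\ldots,y_k)|\frac{dy_1}{y_1}\cdots\frac{dy_k}{y_k}$, with $\mathbb T^k=\{|y_1|=\cdots=|y_k|=1\}$.
   Formalization: Assumes n ≥ 1 and that no A_i is a single point: if A_i = {a} and the family is essential in the hypersurface sense, then Res = ±x_{ia}, whose Mahler measure is 0 but whose Newton polytope is a point, so the equivalence fails (e.g. n = 1, A_0 = {0}, A_1 = {0,1}). *)

theory Defs
  imports
    "HOL-Analysis.Analysis"
    "HOL-Library.Poly_Mapping"
    "HOL-Computational_Algebra.Factorial_Ring"
begin

text \<open>
  Polynomials over \<open>'r\<close> in the indeterminates \<open>'v\<close>: finitely supported maps from exponent vectors
  to coefficients.  A finite type \<open>'v\<close> stands for the set of all the indeterminates
  \<open>X\<^sub>0 \<union> \<dots> \<union> X\<^sub>n\<close>, so that \<open>k = CARD('v)\<close>, and coefficient vectors live in \<open>complex ^ 'v\<close>.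
\<close>

type_synonym ('v, 'r) mpoly = "('v \<Rightarrow>\<^sub>0 nat) \<Rightarrow>\<^sub>0 'r"

definition mpoly_eval :: "'r::comm_semiring_1 ^ 'v \<Rightarrow> ('v::finite, 'r) mpoly \<Rightarrow> 'r" where
  "mpoly_eval c p =
     (\<Sum>m\<in>Poly_Mapping.keys p. Poly_Mapping.lookup p m * (\<Prod>v\<in>UNIV. (c $ v) ^ Poly_Mapping.lookup m v))"

definition mpoly_of_int :: "('v, int) mpoly \<Rightarrow> ('v, complex) mpoly" where
  "mpoly_of_int p = Poly_Mapping.map of_int p"

definition nonconstant_mpoly :: "('v, 'r::zero) mpoly \<Rightarrow> bool" where
  "nonconstant_mpoly p \<longleftrightarrow> (\<exists>m\<in>Poly_Mapping.keys p. m \<noteq> 0)"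

definition primitive_mpoly :: "('v, int) mpoly \<Rightarrow> bool" where
  "primitive_mpoly p \<longleftrightarrow> Gcd (Poly_Mapping.lookup p ` Poly_Mapping.keys p) = 1"

definition zariski_closure :: "(complex ^ 'v::finite) set \<Rightarrow> (complex ^ 'v) set" where
  "zariski_closure S =
     {c. \<forall>p. (\<forall>s\<in>S. mpoly_eval s p = 0) \<longrightarrow> mpoly_eval c p = 0}"

definition is_hypersurface :: "(complex ^ 'v::finite) set \<Rightarrow> bool" where
  "is_hypersurface Z \<longleftrightarrow> (\<exists>p. nonconstant_mpoly p \<and> Z = {c. mpoly_eval c p = 0})"

definition laurent_monomial :: "int ^ 'n::finite \<Rightarrow> complex ^ 'n \<Rightarrow> complex" where
  "laurent_monomial a t = (\<Prod>l\<in>UNIV. (t $ l) powi (a $ l))"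

text \<open>
  Below, \<open>A i\<close> is the \<open>i\<close>-th support and \<open>x i a\<close> is the indeterminate that is the coefficient of
  \<open>t\<close> to the power \<open>a\<close> in \<open>F\<^sub>i\<close>.  A specialization \<open>c\<close> replaces \<open>x i a\<close> by \<open>c $ x i a\<close>.
\<close>

definition specialized_system ::
  "(nat \<Rightarrow> (int ^ 'n::finite) set) \<Rightarrow> (nat \<Rightarrow> int ^ 'n \<Rightarrow> 'v::finite) \<Rightarrow> complex ^ 'v
     \<Rightarrow> nat \<Rightarrow> complex ^ 'n \<Rightarrow> complex" where
  "specialized_system A x c i t = (\<Sum>a\<in>A i. c $ x i a * laurent_monomial a t)"

definition solvable_systems ::
  "(nat \<Rightarrow> (int ^ 'n::finite) set) \<Rightarrow> (nat \<Rightarrow> int ^ 'n \<Rightarrow> 'v::finite) \<Rightarrow> (complex ^ 'v) set" where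
  "solvable_systems A x =
     {c. \<exists>t. (\<forall>l. t $ l \<noteq> 0) \<and> (\<forall>i\<le>CARD('n). specialized_system A x c i t = 0)}"

text \<open>
  The hypersurface condition alone also admits supports consisting of one point.  If \<open>A i = {a}\<close>
  and the closure is a hypersurface, the resultant is the single indeterminate \<open>x i a\<close>, whose Mahler
  measure is 0 and whose Newton polytope is a point.  Sturmfels' combinatorial notion of an
  essential family (\<open>rank J \<ge> card J\<close> for every proper nonempty \<open>J\<close>, taken with \<open>J = {i}\<close>) rules
  this out.  This exclusion is not part of the definition below and has to be assumed separately.
\<close>

definition essential_family ::
  "(nat \<Rightarrow> (int ^ 'n::finite) set) \<Rightarrow> (nat \<Rightarrow> int ^ 'n \<Rightarrow> 'v::finite) \<Rightarrow> bool" where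
  "essential_family A x \<longleftrightarrow> is_hypersurface (zariski_closure (solvable_systems A x))"

text \<open>
  For an essential family this determines \<open>R\<close> up to sign.  A primitive polynomial that is
  irreducible over the integers is nonconstant.
\<close>

definition is_mixed_sparse_resultant ::
  "(nat \<Rightarrow> (int ^ 'n::finite) set) \<Rightarrow> (nat \<Rightarrow> int ^ 'n \<Rightarrow> 'v::finite) \<Rightarrow> ('v, int) mpoly \<Rightarrow> bool" where
  "is_mixed_sparse_resultant A x R \<longleftrightarrow>
     irreducible R \<and> primitive_mpoly R \<and>
     (\<forall>c\<in>solvable_systems A x. mpoly_eval c (mpoly_of_int R) = 0)"

definition newton_polytope :: "('v::finite, 'r::zero) mpoly \<Rightarrow> (real ^ 'v) set" where
  "newton_polytope p =
     convex hull ((\<lambda>m. \<chi> v. real (Poly_Mapping.lookup m v)) ` Poly_Mapping.keys p)"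

text \<open>
  The torus integral with \<open>y\<^sub>v = exp (\<i> \<theta>\<^sub>v)\<close>, \<open>dy\<^sub>v / y\<^sub>v = \<i> d\<theta>\<^sub>v\<close>.  The convention \<open>ln 0 = 0\<close> does not
  matter for \<open>g \<noteq> 0\<close>: the zero set of \<open>g\<close> on the torus has measure zero, and \<open>log |g|\<close> is
  integrable.
\<close>

definition mahler_measure :: "('v::finite, complex) mpoly \<Rightarrow> real" where
  "mahler_measure g =
     1 / (2 * pi) ^ CARD('v) *
     (LINT \<theta>:cbox 0 (\<chi> v. 2 * pi)|lborel. ln (cmod (mpoly_eval (\<chi> v. cis (\<theta> $ v)) g)))"

end

theory Submission
  imports Defs "HOL-Complex_Analysis.Cauchy_Integral_Formula" "HOL-Computational_Algebra.Fundamental_Theorem_Algebra"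
begin

text \<open>
  Let \<open>d\<^sub>i\<close> be the difference of the two points of the \<open>i\<close>-th support, for those \<open>i\<close> whose support has
  exactly two points.

  If the \<open>d\<^sub>i\<close> are linearly dependent, a primitive integer relation between them forces
  \<open>x\<^sup>\<alpha> = \<plusminus>x\<^sup>\<beta>\<close> on every solvable system in the torus.  As the closure of the solvable systems is a
  hypersurface, it contains the whole coset given by this equation, so the binomial divides the
  resultant and agrees with it up to sign.  The Newton polytope is then a segment, and the Mahler
  measure vanishes by Jensen's formula on generic one-parameter fibres \<open>z \<mapsto> R(w z\<^sup>g)\<close>.

  If they are independent, then for every real vector \<open>u\<close> and every small \<open>\<epsilon> > 0\<close> some solvable
  system has coefficients of absolute values \<open>exp (\<epsilon> u\<^sub>v)\<close>: a positive \<open>t\<close> balances the two-term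
  equations, and with three or more terms of nearly equal size the phases can be chosen to close up a
  polygon.  With \<open>u = g\<close> generic, some fibre has a root outside the unit disc, hence so have all nearby
  fibres, and averaging Jensen's formula gives a positive Mahler measure.  With \<open>u\<close> along the
  direction of a hypothetical one-dimensional Newton polytope, a univariate polynomial would have
  infinitely many roots.
\<close>

section \<open>Evaluation of polynomials\<close>


text \<open>Nothing explicit about the resultant is available: it is handled through its vanishing
  on solvable systems, its integrality and its irreducibility. Most arguments therefore restrict a
  polynomial to a curve z -> w z^u whose direction u separates the monomials; the restriction has
  the same coefficients up to nonzero factors, and univariate facts apply. In the dependent case the
  pairing of u with the relation \<mu> is prescribed as well: value 1 moves a point across the
  cosets of \<open>character \<mu>\<close>, value 0 moves it inside one coset. A primitive relation
  is wanted because some integer vector pairs with it to 1. In the independent case integrality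
  supplies the sign: up to a factor of modulus 1 the leading coefficient of a fibre is a nonzero
  integer, so Jensen's value is nonnegative on every fibre, and a root outside the disc on some
  fibres is not compensated on others. The smallness of \<epsilon> makes the terms of each balanced
  equation agree up to a factor 2; three or more lengths in [1, 2] always close up to a
  polygon.\<close>

definition monomial_eval :: "'r::comm_semiring_1 ^ 'v \<Rightarrow> ('v::finite \<Rightarrow>\<^sub>0 nat) \<Rightarrow> 'r" where
  "monomial_eval c m = (\<Prod>v\<in>UNIV. (c $ v) ^ Poly_Mapping.lookup m v)"

definition int_eval :: "complex ^ 'v \<Rightarrow> ('v::finite, int) mpoly \<Rightarrow> complex" where
  "int_eval c P = mpoly_eval c (mpoly_of_int P)"

lemma monomial_eval_0 [simp]: "monomial_eval c 0 = 1"
  by (simp add: monomial_eval_def)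

lemma monomial_eval_add: "monomial_eval c (m + n) = monomial_eval c m * monomial_eval c n"
  by (simp add: monomial_eval_def lookup_add power_add prod.distrib)

lemma lookup_mpoly_of_int [simp]:
  "Poly_Mapping.lookup (mpoly_of_int P) m = of_int (Poly_Mapping.lookup P m)"
  by (simp add: mpoly_of_int_def Poly_Mapping.map.rep_eq when_def)

lemma keys_mpoly_of_int [simp]: "Poly_Mapping.keys (mpoly_of_int P) = Poly_Mapping.keys P"
  by (auto simp: in_keys_iff)

lemma mpoly_eval_monomials:
  "mpoly_eval c p = (\<Sum>m\<in>Poly_Mapping.keys p. Poly_Mapping.lookup p m * monomial_eval c m)"
  by (simp add: mpoly_eval_def monomial_eval_def)

lemma mpoly_eval_superset:
  assumes "finite K" "Poly_Mapping.keys p \<subseteq> K"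
  shows "mpoly_eval c p = (\<Sum>m\<in>K. Poly_Mapping.lookup p m * monomial_eval c m)"
  unfolding mpoly_eval_monomials
  by (rule sum.mono_neutral_left) (use assms in \<open>auto simp: in_keys_iff\<close>)

lemma mpoly_eval_add: "mpoly_eval c (p + q) = mpoly_eval c p + mpoly_eval c q"
proof -
  let ?K = "Poly_Mapping.keys p \<union> Poly_Mapping.keys q"
  have "mpoly_eval c (p + q) = (\<Sum>m\<in>?K. Poly_Mapping.lookup (p + q) m * monomial_eval c m)"
    by (rule mpoly_eval_superset) (use Poly_Mapping.keys_add[of p q] in auto)
  also have "\<dots> = (\<Sum>m\<in>?K. Poly_Mapping.lookup p m * monomial_eval c m) +
      (\<Sum>m\<in>?K. Poly_Mapping.lookup q m * monomial_eval c m)"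
    by (simp add: lookup_add distrib_right sum.distrib)
  also have "\<dots> = mpoly_eval c p + mpoly_eval c q"
    by (simp add: mpoly_eval_superset[where K = ?K])
  finally show ?thesis .
qed

lemma mpoly_eval_0 [simp]: "mpoly_eval c 0 = 0"
  by (simp add: mpoly_eval_def)

lemma mpoly_eval_single [simp]: "mpoly_eval c (Poly_Mapping.single m a) = a * monomial_eval c m"
  by (cases "a = 0") (simp_all add: mpoly_eval_monomials)

lemma mpoly_eval_sum: "mpoly_eval c (\<Sum>i\<in>I. f i) = (\<Sum>i\<in>I. mpoly_eval c (f i))"
  by (induction I rule: infinite_finite_induct) (simp_all add: mpoly_eval_add)

text \<open>Writing both factors as sums of \<open>single\<close> terms turns the convolution in a
  product into a double sum; multiplicativity of evaluation and of \<open>mpoly_of_int\<close> is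
  read off from it.\<close>

lemma mpoly_sum_single:
  fixes p :: "('v, 'r::comm_monoid_add) mpoly"
  shows "p = (\<Sum>m\<in>Poly_Mapping.keys p. Poly_Mapping.single m (Poly_Mapping.lookup p m))"
  by (rule poly_mapping_eqI)
     (simp add: lookup_sum lookup_single when_def sum.delta' in_keys_iff)

lemma mpoly_eval_mult: "mpoly_eval c (p * q) = mpoly_eval c p * mpoly_eval c q"
proof -
  have "p * q = (\<Sum>m\<in>Poly_Mapping.keys p. \<Sum>n\<in>Poly_Mapping.keys q.
      Poly_Mapping.single (m + n) (Poly_Mapping.lookup p m * Poly_Mapping.lookup q n))"
    using arg_cong2[OF mpoly_sum_single[of p] mpoly_sum_single[of q], of "(*)"]
    by (simp add: sum_product mult_single)
  then show ?thesis
    by (simp add: mpoly_eval_sum mpoly_eval_monomials[of c p] mpoly_eval_monomials[of c q]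
      monomial_eval_add sum_product mult.assoc mult.left_commute)
qed

lemma mpoly_of_int_add: "mpoly_of_int (P + Q) = mpoly_of_int P + mpoly_of_int Q"
  by (rule poly_mapping_eqI) (simp add: lookup_add)

lemma mpoly_of_int_0 [simp]: "mpoly_of_int 0 = 0"
  by (rule poly_mapping_eqI) simp

lemma mpoly_of_int_single [simp]:
  "mpoly_of_int (Poly_Mapping.single m a) = Poly_Mapping.single m (of_int a)"
  by (rule poly_mapping_eqI) (simp add: lookup_single when_def)

lemma mpoly_of_int_sum: "mpoly_of_int (\<Sum>i\<in>I. f i) = (\<Sum>i\<in>I. mpoly_of_int (f i))"
  by (induction I rule: infinite_finite_induct) (simp_all add: mpoly_of_int_add)

lemma mpoly_of_int_mult: "mpoly_of_int (P * Q) = mpoly_of_int P * mpoly_of_int Q"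
proof -
  have "P * Q = (\<Sum>m\<in>Poly_Mapping.keys P. \<Sum>n\<in>Poly_Mapping.keys Q.
      Poly_Mapping.single (m + n) (Poly_Mapping.lookup P m * Poly_Mapping.lookup Q n))"
    using arg_cong2[OF mpoly_sum_single[of P] mpoly_sum_single[of Q], of "(*)"]
    by (simp add: sum_product mult_single)
  moreover have "mpoly_of_int P * mpoly_of_int Q =
     (\<Sum>m\<in>Poly_Mapping.keys P. \<Sum>n\<in>Poly_Mapping.keys Q.
      Poly_Mapping.single (m + n) (of_int (Poly_Mapping.lookup P m * Poly_Mapping.lookup Q n)))"
    using arg_cong2[OF mpoly_sum_single[of "mpoly_of_int P"] mpoly_sum_single[of "mpoly_of_int Q"], of "(*)"]
    by (simp add: sum_product mult_single)
  ultimately show ?thesis by (simp add: mpoly_of_int_sum)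
qed

lemma int_eval_add: "int_eval c (P + Q) = int_eval c P + int_eval c Q"
  by (simp add: int_eval_def mpoly_of_int_add mpoly_eval_add)

lemma int_eval_mult: "int_eval c (P * Q) = int_eval c P * int_eval c Q"
  by (simp add: int_eval_def mpoly_of_int_mult mpoly_eval_mult)

lemma int_eval_single [simp]: "int_eval c (Poly_Mapping.single m a) = of_int a * monomial_eval c m"
  by (simp add: int_eval_def)

lemma int_eval_0 [simp]: "int_eval c 0 = 0"
  by (simp add: int_eval_def)

lemma int_eval_diff: "int_eval c (P - Q) = int_eval c P - int_eval c Q"
  using int_eval_add[of c "P - Q" Q] by simp

lemma int_eval_monomials:
  "int_eval c P = (\<Sum>m\<in>Poly_Mapping.keys P. of_int (Poly_Mapping.lookup P m) * monomial_eval c m)"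
  by (simp add: int_eval_def mpoly_eval_monomials)

section \<open>Generic one-parameter subgroups\<close>

text \<open>Powers of one integer T serve as weights: each excluded equation becomes a nonzero
  integer polynomial in T, and finitely many such polynomials have only finitely many roots among
  the naturals.\<close>

lemma generic_direction:
  fixes D :: "(('v::finite \<Rightarrow> int) \<times> int) set"
  assumes "finite D" and nz: "\<And>\<delta> b. (\<delta>, b) \<in> D \<Longrightarrow> \<exists>v. \<delta> v \<noteq> 0"
  obtains g :: "'v \<Rightarrow> nat" where "\<And>\<delta> b. (\<delta>, b) \<in> D \<Longrightarrow> (\<Sum>v\<in>UNIV. int (g v) * \<delta> v) \<noteq> b"
proof -
  obtain e :: "'v \<Rightarrow> nat" where e: "inj e"
    using finite_imp_inj_to_nat_seg[of "UNIV :: 'v set"] by auto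
  \<comment> \<open>The exponents start at 1, so that subtracting the constant b cannot cancel a
    coefficient of \<delta>.\<close>
  define q where "q = (\<lambda>(\<delta>, b). (\<Sum>v\<in>UNIV. monom (\<delta> v) (Suc (e v))) - [:b:] :: int poly)"
  have "q d \<noteq> 0" if "d \<in> D" for d
  proof -
    obtain \<delta> b where d: "d = (\<delta>, b)" by (cases d)
    have "\<exists>v. \<delta> v \<noteq> 0" using nz[of \<delta> b] that d by simp
    then obtain w where w: "\<delta> w \<noteq> 0" by blast
    have "coeff (q d) (Suc (e w)) = (\<Sum>v\<in>UNIV. if v = w then \<delta> v else 0)"
      unfolding q_def d using inj_eq[OF e] by (simp add: coeff_sum)
    then show ?thesis using w by auto
  qed
  then have "finite (\<Union>d\<in>D. {T. poly (q d) T = 0})"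
    using \<open>finite D\<close> by (simp add: poly_roots_finite)
  moreover have "infinite (range int)" by (simp add: range_inj_infinite)
  ultimately have "\<not> range int \<subseteq> (\<Union>d\<in>D. {T. poly (q d) T = 0})"
    using finite_subset by blast
  then obtain T where T: "\<And>d. d \<in> D \<Longrightarrow> poly (q d) (int T) \<noteq> 0" by auto
  show thesis
  proof (rule that)
    fix \<delta> b assume "(\<delta>, b) \<in> D"
    from T[OF this] show "(\<Sum>v\<in>UNIV. int (T ^ Suc (e v)) * \<delta> v) \<noteq> b"
      by (simp add: q_def poly_sum poly_monom mult_ac)
  qed
qed

text \<open>The least positive integer combination of the \<mu> i divides each of them, since a
  nonzero remainder would be a smaller one. Dividing by it makes an integer relation primitive, and
  the Bezout coefficients become the vector that pairs with it to 1.\<close>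

lemma bezout_family:
  fixes \<mu> :: "'i \<Rightarrow> int"
  assumes "finite I" "\<exists>i\<in>I. \<mu> i \<noteq> 0"
  obtains u \<mu>' g where "g > 0" "\<And>i. i \<in> I \<Longrightarrow> \<mu> i = g * \<mu>' i" "(\<Sum>i\<in>I. u i * \<mu>' i) = 1"
proof -
  define P where "P = (\<lambda>n. n > 0 \<and> (\<exists>u. (\<Sum>i\<in>I. u i * \<mu> i) = int n))"
  obtain j where j: "j \<in> I" "\<mu> j \<noteq> 0" using assms by auto
  have "(\<Sum>i\<in>I. (if i = j then sgn (\<mu> j) else 0) * \<mu> i) = (\<Sum>i\<in>I. if i = j then \<bar>\<mu> j\<bar> else 0)"
    by (rule sum.cong) (auto simp: abs_sgn mult.commute)
  also have "\<dots> = int (nat \<bar>\<mu> j\<bar>)" using assms j by simp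
  finally have "P (nat \<bar>\<mu> j\<bar>)" unfolding P_def using j by auto
  then have PL: "P (LEAST n. P n)" and le: "\<And>n. P n \<Longrightarrow> (LEAST n. P n) \<le> n"
    by (auto intro: LeastI Least_le)
  define g where "g = int (LEAST n. P n)"
  obtain u where u: "(\<Sum>i\<in>I. u i * \<mu> i) = g" and g: "g > 0"
    using PL unfolding P_def g_def by auto
  have dvd: "g dvd \<mu> k" if k: "k \<in> I" for k
  proof (rule ccontr)
    assume "\<not> g dvd \<mu> k"
    then have pos: "\<mu> k mod g > 0" using g
      by (metis dvd_eq_mod_eq_0 order_le_less pos_mod_sign)
    have "(\<Sum>i\<in>I. ((if i = k then 1 else 0) - (\<mu> k div g) * u i) * \<mu> i) =
       (\<Sum>i\<in>I. if i = k then \<mu> k else 0) - (\<mu> k div g) * (\<Sum>i\<in>I. u i * \<mu> i)"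
      unfolding sum_distrib_left sum_subtractf[symmetric]
      by (rule sum.cong) (auto simp: algebra_simps)
    also have "\<dots> = \<mu> k mod g" using assms k u by (simp add: minus_div_mult_eq_mod)
    finally have "P (nat (\<mu> k mod g))" unfolding P_def using pos
      by (intro conjI exI) auto
    from le[OF this] have "g \<le> \<mu> k mod g" using pos g_def by linarith
    then show False using pos_mod_bound[OF g, of "\<mu> k"] by simp
  qed
  show thesis
  proof (rule that[of g "\<lambda>i. \<mu> i div g" u])
    show "g > 0" by fact
    show "\<mu> i = g * (\<mu> i div g)" if "i \<in> I" for i using dvd[OF that] by simp
    have "g * (\<Sum>i\<in>I. u i * (\<mu> i div g)) = (\<Sum>i\<in>I. u i * \<mu> i)"
      unfolding sum_distrib_left using dvd by (intro sum.cong) auto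
    then show "(\<Sum>i\<in>I. u i * (\<mu> i div g)) = 1" using u g by simp
  qed
qed

text \<open>A power z^N with N at least every |k m| clears all negative exponents, and the common
  shift by N does not merge distinct terms.\<close>

lemma laurent_as_poly:
  fixes k :: "'a \<Rightarrow> int" and a :: "'a \<Rightarrow> complex"
  assumes "finite K"
  obtains N :: nat and p :: "complex poly"
  where "inj_on k K \<Longrightarrow> inj_on (\<lambda>m. nat (k m + int N)) K" "p = (\<Sum>m\<in>K. monom (a m) (nat (k m + int N)))"
    "\<And>z. z \<noteq> 0 \<Longrightarrow> poly p z = z ^ N * (\<Sum>m\<in>K. a m * z powi k m)"
proof -
  define N where "N = (\<Sum>m\<in>K. nat \<bar>k m\<bar>)"
  have N: "k m + int N \<ge> 0" if "m \<in> K" for m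
  proof -
    have "nat \<bar>k m\<bar> \<le> N" unfolding N_def using that assms by (intro member_le_sum) auto
    then show ?thesis by linarith
  qed
  have ev: "poly (\<Sum>m\<in>K. monom (a m) (nat (k m + int N))) z = z ^ N * (\<Sum>m\<in>K. a m * z powi k m)"
    if z: "z \<noteq> 0" for z
  proof -
    have "z ^ nat (k m + int N) = z ^ N * z powi k m" if "m \<in> K" for m
    proof -
      have "z ^ nat (k m + int N) = z powi (k m + int N)"
        using N[OF that] by (simp add: power_int_def)
      also have "\<dots> = z ^ N * z powi k m" using z by (simp add: power_int_add)
      finally show ?thesis .
    qed
    then show ?thesis
      by (auto simp: poly_sum poly_monom sum_distrib_left mult_ac intro!: sum.cong)
  qed
  have "inj_on (\<lambda>m. nat (k m + int N)) K" if k: "inj_on k K"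
  proof (rule inj_onI)
    fix x y assume "x \<in> K" "y \<in> K" "nat (k x + int N) = nat (k y + int N)"
    then have "k x = k y" using N[of x] N[of y] by linarith
    then show "x = y" using k \<open>x \<in> K\<close> \<open>y \<in> K\<close> by (auto dest: inj_onD)
  qed
  then show thesis by (rule that[OF _ refl ev])
qed

lemma coeff_sum_monom_inj:
  assumes "finite K" "inj_on k K" "m \<in> K"
  shows "coeff (\<Sum>m\<in>K. monom (a m) (k m)) (k m) = a m"
proof -
  have "coeff (\<Sum>m\<in>K. monom (a m) (k m)) (k m) = (\<Sum>j\<in>K. if j = m then a j else 0)"
    unfolding coeff_sum by (rule sum.cong) (use assms in \<open>auto dest: inj_onD\<close>)
  then show ?thesis using assms by simp
qed

lemma laurent_eq_0:
  fixes k :: "'a \<Rightarrow> int" and a :: "'a \<Rightarrow> complex"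
  assumes "finite K" "inj_on k K" and 0: "\<And>z. z \<noteq> 0 \<Longrightarrow> (\<Sum>m\<in>K. a m * z powi k m) = 0"
    and m: "m \<in> K"
  shows "a m = 0"
proof -
  obtain N p where inj: "inj_on (\<lambda>m. nat (k m + int N)) K"
    and p: "p = (\<Sum>m\<in>K. monom (a m) (nat (k m + int N)))"
    and ev: "\<And>z. z \<noteq> 0 \<Longrightarrow> poly p z = z ^ N * (\<Sum>m\<in>K. a m * z powi k m)"
    using laurent_as_poly[OF \<open>finite K\<close>, of k a] \<open>inj_on k K\<close> by metis
  have "p = 0"
  proof (rule ccontr)
    assume "p \<noteq> 0"
    then have "finite {z. poly p z = 0}" by (rule poly_roots_finite)
    moreover have "- {0} \<subseteq> {z. poly p z = 0}" using ev 0 by auto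
    ultimately have "finite (- {0 :: complex})" by (rule rev_finite_subset)
    then show False using infinite_UNIV_char_0[where 'a = complex]
      by (metis Compl_eq_Diff_UNIV finite.emptyI finite_Diff2 finite_insert)
  qed
  then show ?thesis using coeff_sum_monom_inj[OF assms(1) inj m, of a] p by simp
qed

lemma laurent_root:
  fixes k :: "'a \<Rightarrow> int" and a :: "'a \<Rightarrow> complex"
  assumes "finite K" "inj_on k K" "m \<in> K" "n \<in> K" "m \<noteq> n" "a m \<noteq> 0" "a n \<noteq> 0"
  obtains z where "z \<noteq> 0" "(\<Sum>m\<in>K. a m * z powi k m) = 0"
proof -
  obtain N p where inj: "inj_on (\<lambda>m. nat (k m + int N)) K"
    and p: "p = (\<Sum>m\<in>K. monom (a m) (nat (k m + int N)))"
    and ev: "\<And>z. z \<noteq> 0 \<Longrightarrow> poly p z = z ^ N * (\<Sum>m\<in>K. a m * z powi k m)"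
    using laurent_as_poly[OF \<open>finite K\<close>, of k a] \<open>inj_on k K\<close> by metis
  let ?h = "\<lambda>m. nat (k m + int N)"
  have c: "coeff p (?h m) \<noteq> 0" "coeff p (?h n) \<noteq> 0" "?h m \<noteq> ?h n"
    using coeff_sum_monom_inj[OF assms(1) inj, of _ a] assms inj p by (auto dest: inj_onD)
  then have "p \<noteq> 0" by auto
  \<comment> \<open>The full power of X is split off, so that any root of q is nonzero; q is not
    constant because p has two distinct exponents.\<close>
  obtain q where q: "p = [:- 0, 1:] ^ order 0 p * q" "\<not> [:- 0, 1:] dvd q"
    using order_decomp[OF \<open>p \<noteq> 0\<close>] by blast
  have pm: "p = monom 1 (order 0 p) * q" using q(1) by (simp add: monom_altdef)
  have "\<exists>z. poly q z = 0"
  proof (rule ccontr)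
    assume "\<nexists>z. poly q z = 0"
    then have "constant (poly q)" using Fundamental_Theorem_Algebra.fundamental_theorem_of_algebra by blast
    then have "degree q = 0" by (simp add: constant_degree)
    then obtain b where "q = [:b:]" by (rule degree_eq_zeroE)
    then have "p = monom b (order 0 p)" using pm by (simp add: mult_monom smult_monom mult.commute)
    then show False using c by (metis coeff_monom)
  qed
  then obtain z where z: "poly q z = 0" by blast
  then have "z \<noteq> 0" using q(2) by (auto simp: poly_eq_0_iff_dvd)
  moreover have "poly p z = 0" using pm z by (metis mult_zero_right poly_mult)
  ultimately show thesis using that ev[of z] by auto
qed


section \<open>Integer pairings and directions with a prescribed value\<close>

definition dot :: "('v::finite \<Rightarrow> int) \<Rightarrow> ('v \<Rightarrow> int) \<Rightarrow> int" where
  "dot u \<delta> = (\<Sum>v\<in>UNIV. u v * \<delta> v)"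

abbreviation expo :: "('v \<Rightarrow>\<^sub>0 nat) \<Rightarrow> 'v \<Rightarrow> int" where
  "expo m \<equiv> \<lambda>v. int (Poly_Mapping.lookup m v)"

lemma dot_add_left: "dot (\<lambda>v. u v + u' v) \<delta> = dot u \<delta> + dot u' \<delta>"
  by (simp add: dot_def distrib_right sum.distrib)

lemma dot_scale_left: "dot (\<lambda>v. k * u v) \<delta> = k * dot u \<delta>"
  by (simp add: dot_def sum_distrib_left mult.assoc)

lemma dot_diff_right: "dot u (\<lambda>v. \<delta> v - \<delta>' v) = dot u \<delta> - dot u \<delta>'"
  by (simp add: dot_def right_diff_distrib sum_subtractf)

lemma dot_scale_right: "dot u (\<lambda>v. k * \<delta> v) = k * dot u \<delta>"
  by (simp add: dot_def sum_distrib_left mult.left_commute)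

text \<open>With h generic, put u = (e - h.\<mu>) u0 + h, which pairs with \<mu> to e. Then
  u.\<delta> = e (u0.\<delta>) + h.(\<open>proj\<close> \<delta>), where \<open>proj\<close> removes
  the \<mu>-component measured by u0. If \<open>proj\<close> \<delta> is nonzero, h has one value to
  avoid; otherwise \<delta> = k \<mu> and the pairing is e k. For e = 0 the last hypothesis says
  that D contains no multiple of \<mu>.\<close>

lemma generic_direction_slice:
  fixes D :: "('v::finite \<Rightarrow> int) set"
  assumes "finite D" and \<mu>: "dot u\<^sub>0 \<mu> = 1"
    and D: "\<And>\<delta> k. \<delta> \<in> D \<Longrightarrow> \<delta> = (\<lambda>v. k * \<mu> v) \<Longrightarrow> e * k \<noteq> 0"
  obtains u where "dot u \<mu> = e" "\<And>\<delta>. \<delta> \<in> D \<Longrightarrow> dot u \<delta> \<noteq> 0"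
proof -
  define proj where "proj \<delta> = (\<lambda>v. \<delta> v - dot u\<^sub>0 \<delta> * \<mu> v)" for \<delta>
  define D' where "D' = (\<lambda>\<delta>. (proj \<delta>, - (e * dot u\<^sub>0 \<delta>))) ` {\<delta> \<in> D. \<exists>v. proj \<delta> v \<noteq> 0}"
  have "finite D'" using \<open>finite D\<close> by (simp add: D'_def)
  moreover have "\<exists>v. \<delta> v \<noteq> 0" if "(\<delta>, b) \<in> D'" for \<delta> b
    using that by (auto simp: D'_def)
  ultimately obtain g where
    g: "\<And>\<delta> b. (\<delta>, b) \<in> D' \<Longrightarrow> (\<Sum>v\<in>UNIV. int (g v) * \<delta> v) \<noteq> b"
    using generic_direction[of D'] by metis
  define h where "h = (\<lambda>v. int (g v))"
  define u where "u = (\<lambda>v. (e - dot h \<mu>) * u\<^sub>0 v + h v)"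
  have u: "dot u \<delta> = (e - dot h \<mu>) * dot u\<^sub>0 \<delta> + dot h \<delta>" for \<delta>
    by (simp add: u_def dot_add_left dot_scale_left)
  have "dot u \<delta> \<noteq> 0" if \<delta>: "\<delta> \<in> D" for \<delta>
  proof (cases "\<exists>v. proj \<delta> v \<noteq> 0")
    case True
    then have "(proj \<delta>, - (e * dot u\<^sub>0 \<delta>)) \<in> D'" using \<delta> by (auto simp: D'_def)
    from g[OF this] have "dot h (proj \<delta>) \<noteq> - (e * dot u\<^sub>0 \<delta>)" by (simp add: dot_def h_def)
    moreover have "dot h (proj \<delta>) = dot h \<delta> - dot u\<^sub>0 \<delta> * dot h \<mu>"
      by (simp add: proj_def dot_diff_right dot_scale_right)
    ultimately show ?thesis by (simp add: u algebra_simps)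
  next
    case False
    then have eq: "\<delta> = (\<lambda>v. dot u\<^sub>0 \<delta> * \<mu> v)" by (auto simp: proj_def)
    have "dot h \<delta> = dot u\<^sub>0 \<delta> * dot h \<mu>" by (subst eq) (simp add: dot_scale_right)
    then have "dot u \<delta> = e * dot u\<^sub>0 \<delta>" by (simp add: u algebra_simps)
    then show ?thesis using D[OF \<delta> eq] by simp
  qed
  moreover have "dot u \<mu> = e" using \<mu> by (simp add: u)
  ultimately show thesis using that by blast
qed

section \<open>Characters of the torus and twists by one-parameter subgroups\<close>

definition torus_pt :: "complex ^ 'v \<Rightarrow> bool" where
  "torus_pt c \<longleftrightarrow> (\<forall>v. c $ v \<noteq> 0)"

definition character :: "('v::finite \<Rightarrow> int) \<Rightarrow> complex ^ 'v \<Rightarrow> complex" where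
  "character \<mu> c = (\<Prod>v\<in>UNIV. (c $ v) powi \<mu> v)"

definition twist :: "complex ^ 'v \<Rightarrow> complex \<Rightarrow> ('v \<Rightarrow> int) \<Rightarrow> complex ^ 'v" where
  "twist c z u = (\<chi> v. c $ v * z powi u v)"

lemma torus_pt_twist: "torus_pt c \<Longrightarrow> z \<noteq> 0 \<Longrightarrow> torus_pt (twist c z u)"
  by (simp add: torus_pt_def twist_def)

lemma power_int_sum: "z \<noteq> (0::complex) \<Longrightarrow> z powi (\<Sum>i\<in>I. f i) = (\<Prod>i\<in>I. z powi f i)"
  by (induction I rule: infinite_finite_induct) (simp_all add: power_int_add)

lemma character_twist:
  "z \<noteq> 0 \<Longrightarrow> character \<mu> (twist c z u) = character \<mu> c * z powi dot u \<mu>"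
  by (simp add: character_def twist_def dot_def power_int_mult_distrib prod.distrib power_int_sum
    power_int_mult)

lemma monomial_eval_twist:
  "z \<noteq> 0 \<Longrightarrow> monomial_eval (twist c z u) m = monomial_eval c m * z powi dot u (expo m)"
  by (simp add: monomial_eval_def twist_def dot_def power_mult_distrib prod.distrib power_int_sum
    power_int_mult)

lemma monomial_eval_nz: "torus_pt c \<Longrightarrow> monomial_eval c m \<noteq> 0"
  by (simp add: monomial_eval_def torus_pt_def)

lemma mpoly_eval_twist:
  assumes "z \<noteq> 0"
  shows "mpoly_eval (twist c z u) p = (\<Sum>m\<in>Poly_Mapping.keys p.
    (Poly_Mapping.lookup p m * monomial_eval c m) * z powi dot u (expo m))"
  using assms by (simp add: mpoly_eval_monomials monomial_eval_twist mult.assoc)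

definition differences :: "('v \<Rightarrow>\<^sub>0 nat) set \<Rightarrow> ('v \<Rightarrow> int) set" where
  "differences K = {\<delta>. \<exists>m\<in>K. \<exists>n\<in>K. m \<noteq> n \<and> \<delta> = (\<lambda>v. expo m v - expo n v)}"

lemma finite_differences: "finite K \<Longrightarrow> finite (differences K)"
  by (rule finite_subset[of _ "(\<lambda>(m, n) v. expo m v - expo n v) ` (K \<times> K)"])
     (auto simp: differences_def)

lemma differencesE:
  assumes "\<delta> \<in> differences K"
  obtains m n where "m \<in> K" "n \<in> K" "m \<noteq> n" "\<And>v. \<delta> v = expo m v - expo n v"
  using assms unfolding differences_def by blast

lemma differences_nz: "\<delta> \<in> differences K \<Longrightarrow> \<exists>v. \<delta> v \<noteq> 0"
  by (elim differencesE) (metis eq_iff_diff_eq_0 of_nat_eq_iff poly_mapping_eqI)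

lemma inj_on_dot:
  assumes "\<And>\<delta>. \<delta> \<in> differences K \<Longrightarrow> dot u \<delta> \<noteq> 0"
  shows "inj_on (\<lambda>m. dot u (expo m)) K"
proof (rule inj_onI, rule ccontr)
  fix a b assume ab: "a \<in> K" "b \<in> K" "dot u (expo a) = dot u (expo b)" "a \<noteq> b"
  then have "(\<lambda>v. expo a v - expo b v) \<in> differences K" unfolding differences_def by blast
  from assms[OF this] ab(3) show False by (simp add: dot_diff_right)
qed

text \<open>
  Restricting \<open>p\<close> to a curve \<open>z \<mapsto> w z\<^sup>u\<close> with \<open>u \<bullet> \<mu> = 1\<close> that separates the monomials gives a Laurent
  polynomial in \<open>z\<close> with at least two terms, hence a nonzero root, and every such root must be \<open>1\<close>.
\<close>

lemma zero_set_contains_coset: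
  fixes p :: "('v::finite, complex) mpoly"
  assumes p: "p \<noteq> 0" and c\<^sub>0: "torus_pt c\<^sub>0" "mpoly_eval c\<^sub>0 p = 0"
    and \<mu>: "dot u\<^sub>0 \<mu> = 1"
    and sub: "\<And>c. torus_pt c \<Longrightarrow> mpoly_eval c p = 0 \<Longrightarrow> character \<mu> c = \<epsilon>"
    and "\<epsilon> \<noteq> 0" and w: "torus_pt w" "character \<mu> w = \<epsilon>"
  shows "mpoly_eval w p = 0"
proof -
  let ?K = "Poly_Mapping.keys p"
  obtain m where m: "m \<in> ?K" using p by fastforce
  \<comment> \<open>A single term cannot vanish at a point with nonzero coordinates, but p vanishes
    at such a point.\<close>
  have "\<exists>n\<in>?K. n \<noteq> m"
  proof (rule ccontr)
    assume "\<not> ?thesis"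
    then have "?K = {m}" using m by blast
    moreover have "Poly_Mapping.lookup p m \<noteq> 0" using m by (simp add: in_keys_iff)
    ultimately show False using c\<^sub>0 monomial_eval_nz[OF c\<^sub>0(1), of m]
      by (simp add: mpoly_eval_monomials)
  qed
  then obtain n where n: "n \<in> ?K" "m \<noteq> n" by blast
  have "1 * k \<noteq> 0" if "\<delta> \<in> differences ?K" "\<delta> = (\<lambda>v. k * \<mu> v)" for \<delta> k
    using differences_nz[OF that(1)] that(2) by auto
  then obtain u where u: "dot u \<mu> = 1" "\<And>\<delta>. \<delta> \<in> differences ?K \<Longrightarrow> dot u \<delta> \<noteq> 0"
    using generic_direction_slice[OF finite_differences[OF finite_keys] \<mu>, of p 1] by metis
  have inj: "inj_on (\<lambda>m. dot u (expo m)) ?K" by (rule inj_on_dot[OF u(2)])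
  obtain z where z: "z \<noteq> 0" and 0: "(\<Sum>m\<in>?K.
    (Poly_Mapping.lookup p m * monomial_eval w m) * z powi dot u (expo m)) = 0"
    by (rule laurent_root[OF finite_keys inj m n(1) n(2),
          of "\<lambda>m. Poly_Mapping.lookup p m * monomial_eval w m"])
       (use m n monomial_eval_nz[OF w(1)] in \<open>auto simp: in_keys_iff\<close>)
  then have z0: "mpoly_eval (twist w z u) p = 0" by (simp add: mpoly_eval_twist)
  have "character \<mu> (twist w z u) = \<epsilon>" by (rule sub[OF torus_pt_twist[OF w(1) z] z0])
  \<comment> \<open>The twist multiplies the character by z to the power u.\<mu> = 1, while both
    points have the same nonzero value \<epsilon>.\<close>
  then have "z = 1" using character_twist[OF z, of \<mu> w u] w(2) u(1) \<open>\<epsilon> \<noteq> 0\<close> by simp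
  then have "twist w z u = w" by (simp add: twist_def vec_eq_iff)
  then show ?thesis using z0 by simp
qed

section \<open>Binomials of characters and division by them\<close>

definition pos_part :: "('v::finite \<Rightarrow> int) \<Rightarrow> 'v \<Rightarrow>\<^sub>0 nat" where
  "pos_part \<mu> = Abs_poly_mapping (\<lambda>v. nat (\<mu> v))"

lemma lookup_pos_part [simp]: "Poly_Mapping.lookup (pos_part \<mu>) v = nat (\<mu> v)"
  by (simp add: pos_part_def lookup_Abs_poly_mapping)

text \<open>The equation \<open>character \<mu> c = e\<close> with denominators cleared. The two
  exponent vectors are the positive and negative parts of \<mu>, so no indeterminate occurs in both
  monomials.\<close>

definition binomial :: "('v::finite \<Rightarrow> int) \<Rightarrow> int \<Rightarrow> ('v, int) mpoly" where
  "binomial \<mu> e = Poly_Mapping.single (pos_part \<mu>) 1 - Poly_Mapping.single (pos_part (\<lambda>v. - \<mu> v)) e"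

lemma character_parts:
  assumes "torus_pt c"
  shows "character \<mu> c * monomial_eval c (pos_part (\<lambda>v. - \<mu> v)) = monomial_eval c (pos_part \<mu>)"
  unfolding character_def monomial_eval_def prod.distrib[symmetric]
proof (rule prod.cong[OF refl])
  fix v :: 'a
  have "c $ v \<noteq> 0" using assms by (simp add: torus_pt_def)
  then show "(c $ v) powi \<mu> v * (c $ v) ^ Poly_Mapping.lookup (pos_part (\<lambda>v. - \<mu> v)) v =
      (c $ v) ^ Poly_Mapping.lookup (pos_part \<mu>) v"
    by (cases "\<mu> v \<ge> 0") (simp_all add: power_int_def power_inverse)
qed

lemma int_eval_binomial_eq_0_iff:
  assumes "torus_pt c"
  shows "int_eval c (binomial \<mu> e) = 0 \<longleftrightarrow> character \<mu> c = of_int e"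
  using character_parts[OF assms, of \<mu>] monomial_eval_nz[OF assms, of "pos_part (\<lambda>v. - \<mu> v)"]
  by (auto simp: binomial_def int_eval_diff)

text \<open>A monomial divisible by the first term of the binomial is rewritten with the second. As
  \<mu> v > 0, the indeterminate v does not occur in the second term, so each rewriting lowers the
  exponent of v and the process ends.\<close>

lemma reduce_mod_binomial:
  fixes P :: "('v::finite, int) mpoly"
  assumes v: "\<mu> v > 0"
  obtains Q P' where "P = Q * binomial \<mu> e + P'"
    "\<And>m. m \<in> Poly_Mapping.keys P' \<Longrightarrow> \<exists>v. expo m v < \<mu> v"
proof -
  let ?\<alpha> = "pos_part \<mu>" and ?\<beta> = "pos_part (\<lambda>v. - \<mu> v)"
  define red where "red = (\<lambda>P :: ('v, int) mpoly. \<exists>Q P'. P = Q * binomial \<mu> e + P' \<and>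
    (\<forall>m\<in>Poly_Mapping.keys P'. \<exists>v. expo m v < \<mu> v))"
  have zero: "red 0" unfolding red_def by (rule exI[of _ 0], rule exI[of _ 0]) simp
  have add: "red (P + P')" if "red P" "red P'" for P P'
  proof -
    from that obtain Q T Q' T' where Q: "P = Q * binomial \<mu> e + T" "P' = Q' * binomial \<mu> e + T'"
      and T: "\<forall>m\<in>Poly_Mapping.keys T. \<exists>v. expo m v < \<mu> v" "\<forall>m\<in>Poly_Mapping.keys T'. \<exists>v. expo m v < \<mu> v"
      unfolding red_def by blast
    have "P + P' = (Q + Q') * binomial \<mu> e + (T + T')" using Q by (simp add: distrib_right)
    moreover have "\<forall>m\<in>Poly_Mapping.keys (T + T'). \<exists>v. expo m v < \<mu> v"
      using T Poly_Mapping.keys_add[of T T'] by blast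
    ultimately show ?thesis unfolding red_def by blast
  qed
  have single: "red (Poly_Mapping.single m a)" for m a
  proof (induction "Poly_Mapping.lookup m v" arbitrary: m a rule: less_induct)
    case less
    show ?case
    proof (cases "\<exists>v. expo m v < \<mu> v")
      case True
      then show ?thesis unfolding red_def
        by (intro exI[of _ 0] exI[of _ "Poly_Mapping.single m a"]) simp
    next
      case False
      \<comment> \<open>Subtraction of exponents is truncated; here it is a true difference because
        m dominates the positive part of \<mu>.\<close>
      define n where "n = m - ?\<alpha>"
      have m: "m = n + ?\<alpha>"
      proof (rule poly_mapping_eqI)
        fix v
        have "\<mu> v \<le> expo m v" using False by (simp add: not_less)
        then show "Poly_Mapping.lookup m v = Poly_Mapping.lookup (n + ?\<alpha>) v"
          by (simp add: n_def lookup_add lookup_minus)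
      qed
      have "Poly_Mapping.lookup (n + ?\<beta>) v < Poly_Mapping.lookup m v"
        using v unfolding m by (simp add: lookup_add)
      then have "red (Poly_Mapping.single (n + ?\<beta>) (a * e))" by (rule less)
      then obtain Q T where QT: "Poly_Mapping.single (n + ?\<beta>) (a * e) = Q * binomial \<mu> e + T"
        "\<forall>m\<in>Poly_Mapping.keys T. \<exists>v. expo m v < \<mu> v" unfolding red_def by blast
      have "Poly_Mapping.single n a * binomial \<mu> e =
        Poly_Mapping.single m a - Poly_Mapping.single (n + ?\<beta>) (a * e)"
        by (simp add: binomial_def right_diff_distrib mult_single m)
      then have "Poly_Mapping.single m a =
          Poly_Mapping.single n a * binomial \<mu> e + Poly_Mapping.single (n + ?\<beta>) (a * e)" by simp
      also have "\<dots> = (Poly_Mapping.single n a + Q) * binomial \<mu> e + T"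
        unfolding QT(1) by (simp add: distrib_right)
      finally show ?thesis unfolding red_def using QT(2) by blast
    qed
  qed
  have "red (\<Sum>m\<in>K. Poly_Mapping.single m (f m))" for K and f :: "_ \<Rightarrow> int"
    by (induction K rule: infinite_finite_induct) (auto intro: zero add single)
  then have "red P" using mpoly_sum_single[of P] by metis
  then show thesis unfolding red_def using that by blast
qed

text \<open>In the remainder no two exponents differ by a multiple of \<mu>, for the larger one
  would dominate the positive part of \<mu>. Hence some u with u.\<mu> = 0 separates its monomials.
  The curve w z^u stays in the coset, so the remainder vanishes along it and each of its
  coefficients is zero.\<close>

lemma binomial_dvd:
  fixes R :: "('v::finite, int) mpoly"
  assumes v: "\<mu> v > 0" and \<mu>: "dot u\<^sub>0 \<mu> = 1"
    and w: "torus_pt w" "character \<mu> w = of_int e"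
    and van: "\<And>c. torus_pt c \<Longrightarrow> character \<mu> c = of_int e \<Longrightarrow> int_eval c R = 0"
  obtains Q where "R = Q * binomial \<mu> e"
proof -
  obtain Q P where QP: "R = Q * binomial \<mu> e + P"
    and red: "\<And>m. m \<in> Poly_Mapping.keys P \<Longrightarrow> \<exists>v. expo m v < \<mu> v"
    using reduce_mod_binomial[of \<mu> v R e, OF v] by metis
  let ?K = "Poly_Mapping.keys P"
  have P0: "int_eval c P = 0" if "torus_pt c" "character \<mu> c = of_int e" for c
    using van[OF that] int_eval_binomial_eq_0_iff[OF that(1), of \<mu> e] that(2)
    by (simp add: QP int_eval_add int_eval_mult)
  have False if "\<delta> \<in> differences ?K" and k: "\<delta> = (\<lambda>v. k * \<mu> v)" for \<delta> k
  proof -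
    have pos: False if "m \<in> ?K" "n \<in> ?K" "\<And>v. expo m v - expo n v = k * \<mu> v" "k > 0" for m n k
    proof -
      have "\<exists>v. expo m v < \<mu> v" using red[OF that(1)] .
      then obtain v where v: "expo m v < \<mu> v" by blast
      have "\<mu> v > 0" using v by linarith
      then have "k * \<mu> v \<ge> \<mu> v" using \<open>k > 0\<close> by simp
      then show False using that(3)[of v] v by linarith
    qed
    obtain m n where mn': "m \<in> ?K" "n \<in> ?K" "m \<noteq> n" "\<And>v. \<delta> v = expo m v - expo n v"
      using differencesE[OF \<open>\<delta> \<in> differences ?K\<close>] by metis
    have mn: "m \<in> ?K" "n \<in> ?K" "m \<noteq> n" "\<And>v. expo m v - expo n v = k * \<mu> v"
      using mn' fun_cong[OF k] by auto
    have "k \<noteq> 0"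
    proof
      assume "k = 0"
      then have "m = n" using mn(4) by (intro poly_mapping_eqI) simp
      then show False using mn(3) by simp
    qed
    moreover have *: "expo n v - expo m v = (- k) * \<mu> v" for v
      using mn(4)[of v] by simp
    ultimately consider "k > 0" | "- k > 0" by linarith
    then show False by cases (use pos[OF mn(1,2,4)] pos[OF mn(2,1), of "- k"] * in auto)
  qed
  then obtain u where u: "dot u \<mu> = 0" "\<And>\<delta>. \<delta> \<in> differences ?K \<Longrightarrow> dot u \<delta> \<noteq> 0"
    using generic_direction_slice[OF finite_differences[OF finite_keys] \<mu>, of P 0] by metis
  have inj: "inj_on (\<lambda>m. dot u (expo m)) ?K" by (rule inj_on_dot[OF u(2)])
  have van': "(\<Sum>m\<in>?K. (of_int (Poly_Mapping.lookup P m) * monomial_eval w m) *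
      z powi dot u (expo m)) = 0" if z: "z \<noteq> 0" for z
    using P0[OF torus_pt_twist[OF w(1) z, of u]] w(2) u(1)
    by (simp add: int_eval_def mpoly_eval_twist character_twist z)
  have "of_int (Poly_Mapping.lookup P m) * monomial_eval w m = 0" if "m \<in> ?K" for m
    by (rule laurent_eq_0[OF finite_keys inj van' that])
  then have "Poly_Mapping.lookup P m = 0" for m
    using monomial_eval_nz[OF w(1), of m] by (cases "m \<in> ?K") (auto simp: in_keys_iff)
  then have "P = 0" by (intro poly_mapping_eqI) simp
  then show thesis using QP that by simp
qed

section \<open>Restriction to monomial curves, units and irreducibility\<close>

definition fibre :: "complex ^ 'v \<Rightarrow> ('v::finite \<Rightarrow> nat) \<Rightarrow> ('v, complex) mpoly \<Rightarrow> complex poly" where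
  "fibre w g p = (\<Sum>m\<in>Poly_Mapping.keys p. monom (Poly_Mapping.lookup p m * monomial_eval w m)
     (\<Sum>v\<in>UNIV. g v * Poly_Mapping.lookup m v))"

lemma poly_fibre: "poly (fibre w g p) z = mpoly_eval (\<chi> v. w $ v * z ^ g v) p"
proof -
  have "monomial_eval (\<chi> v. w $ v * z ^ g v) m =
      monomial_eval w m * z ^ (\<Sum>v\<in>UNIV. g v * Poly_Mapping.lookup m v)" for m
    by (simp add: monomial_eval_def power_mult_distrib prod.distrib power_sum power_mult)
  then show ?thesis
    by (simp add: fibre_def poly_sum poly_monom mpoly_eval_monomials mult.assoc)
qed

text \<open>Injectivity means that the weight is nonzero on all differences of exponents. Each
  coefficient of a fibre then stems from a single monomial, so nothing can cancel.\<close>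

lemma separating_weights:
  fixes K :: "('v::finite \<Rightarrow>\<^sub>0 nat) set"
  assumes "finite K"
  obtains g :: "'v \<Rightarrow> nat" where "inj_on (\<lambda>m. \<Sum>v\<in>UNIV. g v * Poly_Mapping.lookup m v) K"
proof -
  have "finite (differences K \<times> {0 :: int})" using assms by (simp add: finite_differences)
  moreover have "\<exists>v. \<delta> v \<noteq> 0" if "(\<delta>, b) \<in> differences K \<times> {0 :: int}" for \<delta> b
    by (rule differences_nz[of _ K]) (use that in simp)
  ultimately obtain g where g: "\<And>\<delta> b. (\<delta>, b) \<in> differences K \<times> {0} \<Longrightarrow>
      (\<Sum>v\<in>UNIV. int (g v) * \<delta> v) \<noteq> b"
    using generic_direction[of "differences K \<times> {0}"] by blast
  have inj: "inj_on (\<lambda>m. dot (\<lambda>v. int (g v)) (expo m)) K"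
    by (rule inj_on_dot) (use g in \<open>auto simp: dot_def\<close>)
  have eq: "dot (\<lambda>v. int (g v)) (expo m) = int (\<Sum>v\<in>UNIV. g v * Poly_Mapping.lookup m v)" for m
    by (simp add: dot_def)
  show thesis
    by (rule that[of g], rule inj_onI, rule inj_onD[OF inj]) (simp_all only: eq)
qed

lemma coeff_fibre:
  assumes "inj_on (\<lambda>m. \<Sum>v\<in>UNIV. g v * Poly_Mapping.lookup m v) (Poly_Mapping.keys p)"
    "m \<in> Poly_Mapping.keys p"
  shows "coeff (fibre w g p) (\<Sum>v\<in>UNIV. g v * Poly_Mapping.lookup m v) =
    Poly_Mapping.lookup p m * monomial_eval w m"
  unfolding fibre_def by (rule coeff_sum_monom_inj[OF finite_keys assms])

text \<open>On a separating curve through the all-ones point a unit becomes a unit of C[z], hence a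
  constant polynomial; every monomial of P leaves a nonzero coefficient there, so its weight must be
  0.\<close>

lemma int_mpoly_unit:
  fixes P :: "('v::finite, int) mpoly"
  assumes "P dvd 1"
  obtains a where "P = Poly_Mapping.single 0 a" "\<bar>a\<bar> = 1"
proof -
  obtain Q where PQ: "P * Q = 1" using assms by (metis dvdE)
  have const: "Poly_Mapping.keys P \<subseteq> {0}" if PQ: "P * Q = 1" for P Q :: "('v, int) mpoly"
  proof -
    \<comment> \<open>The exponent 0 is included so that a monomial of weight 0 is forced to be the
      constant one.\<close>
    obtain g :: "'v \<Rightarrow> nat" where
      g: "inj_on (\<lambda>m. \<Sum>v\<in>UNIV. g v * Poly_Mapping.lookup m v) (insert 0 (Poly_Mapping.keys P))"
      using separating_weights[of "insert 0 (Poly_Mapping.keys P)"] by auto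
    let ?f = "\<lambda>P. fibre 1 g (mpoly_of_int P)"
    have "poly (?f P * ?f Q) z = poly 1 z" for z
    proof -
      have "poly (?f P * ?f Q) z = int_eval (\<chi> v. 1 $ v * z ^ g v) (P * Q)"
        by (simp add: poly_fibre int_eval_mult) (simp add: int_eval_def)
      also have "\<dots> = 1" unfolding PQ single_one[symmetric] by (simp del: single_one)
      finally show ?thesis by simp
    qed
    then have "?f P * ?f Q = 1" using poly_eq_poly_eq_iff by blast
    then have "?f P dvd 1" by (metis dvd_triv_left)
    then have deg: "degree (?f P) = 0" using dvd_imp_degree_le[of "?f P" 1] by simp
    show ?thesis
    proof
      fix m assume m: "m \<in> Poly_Mapping.keys P"
      have "coeff (?f P) (\<Sum>v\<in>UNIV. g v * Poly_Mapping.lookup m v) \<noteq> 0"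
        using coeff_fibre[of g "mpoly_of_int P" m 1] m inj_on_subset[OF g subset_insertI]
          monomial_eval_nz[of 1 m]
        by (simp add: in_keys_iff torus_pt_def)
      then have "(\<Sum>v\<in>UNIV. g v * Poly_Mapping.lookup m v) = 0"
        using deg le_degree by fastforce
      then show "m \<in> {0}" using g m by (auto dest!: inj_onD[of _ _ m 0])
    qed
  qed
  have sing: "P = Poly_Mapping.single 0 (Poly_Mapping.lookup P 0)"
    if "Poly_Mapping.keys P \<subseteq> {0}" for P :: "('v, int) mpoly"
    using that by (intro poly_mapping_eqI) (auto simp: lookup_single when_def in_keys_iff)
  let ?a = "Poly_Mapping.lookup P 0" and ?b = "Poly_Mapping.lookup Q 0"
  have P: "P = Poly_Mapping.single 0 ?a" by (rule sing[OF const[OF PQ]])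
  have Q: "Q = Poly_Mapping.single 0 ?b" using const[of Q P] PQ by (intro sing) (simp add: mult.commute)
  have "Poly_Mapping.single 0 (?a * ?b) = (1 :: ('v, int) mpoly)"
    using PQ by (subst (asm) P, subst (asm) Q) (simp add: mult_single)
  then have "?a * ?b = 1" by (metis lookup_one lookup_single_eq when_simps(1))
  then have "\<bar>?a\<bar> = 1" by (metis abs_mult_self_eq zmult_eq_1_iff abs_1 abs_minus)
  with P show thesis using that by blast
qed

text \<open>The character equation passes to the closure, so the torus zeros of p lie in one coset,
  and \<open>zero_set_contains_coset\<close> shows that they fill it. As R vanishes on the closure,
  the binomial divides R; it is not a unit because it vanishes at a point, so irreducibility leaves
  a cofactor of \<plusminus>1.\<close>

lemma irreducible_vanishing_on_coset:
  fixes R :: "('v::finite, int) mpoly"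
  assumes v: "\<mu> v > 0" and \<mu>: "dot u\<^sub>0 \<mu> = 1" and e: "\<bar>e\<bar> = 1"
    and S: "\<And>c. c \<in> S \<Longrightarrow> torus_pt c \<Longrightarrow> character \<mu> c = of_int e"
    and c\<^sub>0: "c\<^sub>0 \<in> S" "torus_pt c\<^sub>0"
    and hyp: "is_hypersurface (zariski_closure S)"
    and irr: "irreducible R" and van: "\<And>c. c \<in> S \<Longrightarrow> int_eval c R = 0"
  obtains \<alpha> \<beta> where "\<alpha> \<noteq> \<beta>" "Poly_Mapping.keys R = {\<alpha>, \<beta>}"
    "\<bar>Poly_Mapping.lookup R \<alpha>\<bar> = 1" "\<bar>Poly_Mapping.lookup R \<beta>\<bar> = 1"
proof -
  let ?\<alpha> = "pos_part \<mu>" and ?\<beta> = "pos_part (\<lambda>v. - \<mu> v)" and ?\<omega> = "pos_part (\<lambda>v. 1)"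
  obtain p where p: "nonconstant_mpoly p" "zariski_closure S = {c. mpoly_eval c p = 0}"
    using hyp by (auto simp: is_hypersurface_def)
  have sub: "S \<subseteq> zariski_closure S" by (auto simp: zariski_closure_def)
  have clo: "character \<mu> c = of_int e" if c: "torus_pt c" "c \<in> zariski_closure S" for c
  proof -
    \<comment> \<open>The product of all indeterminates makes the test polynomial vanish also at the
      points of S with a zero coordinate, where the character equation says nothing.\<close>
    let ?P = "Poly_Mapping.single ?\<omega> 1 * mpoly_of_int (binomial \<mu> e)"
    have "mpoly_eval s ?P = 0" if s: "s \<in> S" for s
    proof (cases "torus_pt s")
      case True
      then show ?thesis using int_eval_binomial_eq_0_iff[OF True] S[OF s]
        by (simp add: mpoly_eval_mult int_eval_def)
    next
      case False
      then show ?thesis by (auto simp: mpoly_eval_mult monomial_eval_def torus_pt_def)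
    qed
    then have "mpoly_eval c ?P = 0" using c(2) by (auto simp: zariski_closure_def)
    then have "int_eval c (binomial \<mu> e) = 0" using monomial_eval_nz[OF c(1), of ?\<omega>]
      by (simp add: mpoly_eval_mult int_eval_def)
    then show ?thesis using int_eval_binomial_eq_0_iff[OF c(1)] by blast
  qed
  have "int_eval c R = 0" if c: "torus_pt c" "character \<mu> c = of_int e" for c
  proof -
    have "mpoly_eval c p = 0"
    proof (rule zero_set_contains_coset[OF _ c\<^sub>0(2) _ \<mu> _ _ c])
      show "p \<noteq> 0" using p(1) by (auto simp: nonconstant_mpoly_def)
      show "mpoly_eval c\<^sub>0 p = 0" using p(2) sub c\<^sub>0(1) by blast
      show "(of_int e :: complex) \<noteq> 0" using e by auto
    qed (use clo p(2) in blast)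
    then have "c \<in> zariski_closure S" using p(2) by blast
    then show ?thesis using van by (auto simp: zariski_closure_def int_eval_def)
  qed
  then obtain Q where Q: "R = Q * binomial \<mu> e"
    using binomial_dvd[OF v \<mu> c\<^sub>0(2) S[OF c\<^sub>0]] by blast
  have "\<not> binomial \<mu> e dvd 1"
  proof
    assume "binomial \<mu> e dvd 1"
    then obtain a where "binomial \<mu> e = Poly_Mapping.single 0 a" "\<bar>a\<bar> = 1" by (rule int_mpoly_unit)
    moreover have "int_eval c\<^sub>0 (binomial \<mu> e) = 0"
      using int_eval_binomial_eq_0_iff[OF c\<^sub>0(2)] S[OF c\<^sub>0] by blast
    ultimately show False by simp
  qed
  then have "Q dvd 1" using irreducibleD[OF irr Q] by blast
  then obtain a where a: "Q = Poly_Mapping.single 0 a" "\<bar>a\<bar> = 1" by (rule int_mpoly_unit)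
  have R: "R = Poly_Mapping.single ?\<alpha> a - Poly_Mapping.single ?\<beta> (a * e)"
    by (simp add: Q a(1) binomial_def right_diff_distrib mult_single)
  have "Poly_Mapping.lookup ?\<alpha> v \<noteq> Poly_Mapping.lookup ?\<beta> v" using v by simp
  then have ne: "?\<alpha> \<noteq> ?\<beta>" by metis
  then have l: "Poly_Mapping.lookup R ?\<alpha> = a" "Poly_Mapping.lookup R ?\<beta> = - (a * e)"
    by (simp_all add: R lookup_minus lookup_single when_def)
  have "Poly_Mapping.keys R = {?\<alpha>, ?\<beta>}"
    using ne a(2) e by (auto simp: R in_keys_iff lookup_minus lookup_single when_def split: if_splits)
  then show thesis using that[OF ne] l a(2) e by (simp add: abs_mult)
qed


section \<open>Linear algebra over the integers\<close>

lemma dot_commute: "dot u \<delta> = dot \<delta> u"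
  by (simp add: dot_def mult.commute)

lemma dot_diff_left: "dot (\<lambda>v. u v - u' v) \<delta> = dot u \<delta> - dot u' \<delta>"
  by (simp add: dot_def left_diff_distrib sum_subtractf)

lemma dot_sum_left: "dot (\<lambda>v. \<Sum>i\<in>I. f i v) \<delta> = (\<Sum>i\<in>I. dot (f i) \<delta>)"
  unfolding dot_def sum_distrib_right by (rule sum.swap)

lemma dot_self_eq_0: "dot e e = 0 \<Longrightarrow> e v = 0"
  unfolding dot_def by (subst (asm) sum_nonneg_eq_0_iff) auto

text \<open>A fraction-free construction of dual vectors with a common denominator D. For a new d j,
  the vector e is D times d j minus the part seen by the old duals, and it is nonzero by
  independence. Correcting D e by the old duals gives \<sigma>, which annihilates the old family and
  satisfies \<sigma>.(d j) = e.e > 0. The old duals are then corrected by \<sigma>, with new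
  denominator D (\<sigma>.(d j)).\<close>

lemma dual_family:
  fixes d :: "'i \<Rightarrow> 'n::finite \<Rightarrow> int"
  assumes "finite I"
    and "\<And>\<nu>. (\<And>l. (\<Sum>i\<in>I. \<nu> i * d i l) = 0) \<Longrightarrow> \<forall>i\<in>I. \<nu> i = 0"
  shows "\<exists>\<tau> D. D \<noteq> 0 \<and> (\<forall>i\<in>I. \<forall>k\<in>I. dot (\<tau> i) (d k) = (if i = k then D else 0))"
  using assms
proof (induction I rule: finite_induct)
  case empty
  show ?case by (rule exI, rule exI[of _ 1]) simp
next
  case (insert j I)
  have "\<exists>\<tau> D. D \<noteq> 0 \<and> (\<forall>i\<in>I. \<forall>k\<in>I. dot (\<tau> i) (d k) = (if i = k then D else 0))"
  proof (rule insert.IH)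
    fix \<nu> assume *: "\<And>l. (\<Sum>i\<in>I. \<nu> i * d i l) = 0"
    have "(\<Sum>i\<in>insert j I. (if i \<in> I then \<nu> i else 0) * d i l) = 0" for l
      using * insert.hyps by (simp cong: sum.cong)
    from insert.prems[OF this] show "\<forall>i\<in>I. \<nu> i = 0" by simp
  qed
  then obtain \<tau> D where D: "D \<noteq> 0"
    and \<tau>: "\<And>i k. i \<in> I \<Longrightarrow> k \<in> I \<Longrightarrow> dot (\<tau> i) (d k) = (if i = k then D else 0)" by blast
  define e where "e = (\<lambda>v. D * d j v - (\<Sum>i\<in>I. dot (\<tau> i) (d j) * d i v))"
  have "dot e e \<noteq> 0"
  proof
    assume "dot e e = 0"
    then have e0: "e v = 0" for v by (rule dot_self_eq_0)
    have "(\<Sum>i\<in>insert j I. (if i = j then D else - dot (\<tau> i) (d j)) * d i l) = e l" for l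
    proof -
      have "(\<Sum>i\<in>I. (if i = j then D else - dot (\<tau> i) (d j)) * d i l) =
          (\<Sum>i\<in>I. - (dot (\<tau> i) (d j) * d i l))"
        by (rule sum.cong) (use insert.hyps in auto)
      then show ?thesis using insert.hyps by (simp add: e_def sum_negf)
    qed
    then have "\<forall>i\<in>insert j I. (if i = j then D else - dot (\<tau> i) (d j)) = 0"
      using e0 by (intro insert.prems) simp
    then show False using D by auto
  qed
  define \<sigma> where "\<sigma> = (\<lambda>v. D * e v - (\<Sum>i\<in>I. dot e (d i) * \<tau> i v))"
  have \<sigma>: "dot \<sigma> \<delta> = D * dot e \<delta> - (\<Sum>i\<in>I. dot e (d i) * dot (\<tau> i) \<delta>)" for \<delta>
    by (simp add: \<sigma>_def dot_diff_left dot_scale_left dot_sum_left)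
  have \<sigma>k: "dot \<sigma> (d k) = 0" if "k \<in> I" for k
  proof -
    have "(\<Sum>i\<in>I. dot e (d i) * dot (\<tau> i) (d k)) = (\<Sum>i\<in>I. if i = k then dot e (d i) * D else 0)"
      by (rule sum.cong) (use \<tau> that in auto)
    then show ?thesis using that insert.hyps by (simp add: \<sigma>)
  qed
  have "dot e e = dot (\<lambda>v. D * d j v - (\<Sum>i\<in>I. dot (\<tau> i) (d j) * d i v)) e"
    by (simp add: e_def)
  also have "\<dots> = D * dot (d j) e - (\<Sum>i\<in>I. dot (\<tau> i) (d j) * dot (d i) e)"
    by (simp add: dot_diff_left dot_scale_left dot_sum_left)
  also have "\<dots> = dot \<sigma> (d j)"
    by (simp add: \<sigma> dot_commute[of "d _" e] mult.commute[of "dot (\<tau> _) (d j)"])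
  finally have s: "dot \<sigma> (d j) \<noteq> 0" using \<open>dot e e \<noteq> 0\<close> by simp
  define \<tau>' where "\<tau>' = (\<lambda>i. if i = j then (\<lambda>v. D * \<sigma> v)
    else (\<lambda>v. dot \<sigma> (d j) * \<tau> i v - dot (\<tau> i) (d j) * \<sigma> v))"
  have "dot (\<tau>' i) (d k) = (if i = k then D * dot \<sigma> (d j) else 0)"
    if "i \<in> insert j I" "k \<in> insert j I" for i k
    using that insert.hyps \<tau> \<sigma>k
    by (auto simp: \<tau>'_def dot_diff_left dot_scale_left split: if_splits)
  moreover have "D * dot \<sigma> (d j) \<noteq> 0" using D s by simp
  ultimately show ?case by blast
qed

text \<open>The solution is the combination of the dual vectors with coefficients b i / D; thus
  independence over the integers already yields solvability for real right-hand sides.\<close>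

lemma independent_solvable:
  fixes d :: "'i \<Rightarrow> 'n::finite \<Rightarrow> int" and b :: "'i \<Rightarrow> real"
  assumes "finite I"
    and "\<And>\<nu>. (\<And>l. (\<Sum>i\<in>I. \<nu> i * d i l) = 0) \<Longrightarrow> \<forall>i\<in>I. \<nu> i = 0"
  obtains t :: "'n \<Rightarrow> real" where "\<And>i. i \<in> I \<Longrightarrow> (\<Sum>l\<in>UNIV. t l * real_of_int (d i l)) = b i"
proof -
  have "\<exists>\<tau> D. D \<noteq> 0 \<and> (\<forall>i\<in>I. \<forall>k\<in>I. dot (\<tau> i) (d k) = (if i = k then D else 0))"
    by (rule dual_family) (use assms in auto)
  then obtain \<tau> D where D: "D \<noteq> 0"
    and \<tau>: "\<forall>i\<in>I. \<forall>k\<in>I. dot (\<tau> i) (d k) = (if i = k then D else 0)"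
    by (elim exE conjE)
  define t where "t l = (\<Sum>i\<in>I. b i * real_of_int (\<tau> i l)) / real_of_int D" for l
  have "(\<Sum>l\<in>UNIV. t l * real_of_int (d k l)) = b k" if k: "k \<in> I" for k
  proof -
    have "(\<Sum>l\<in>UNIV. t l * real_of_int (d k l)) =
        (\<Sum>l\<in>UNIV. \<Sum>i\<in>I. b i * real_of_int (\<tau> i l * d k l) / real_of_int D)"
      by (simp add: t_def sum_divide_distrib sum_distrib_right mult.assoc)
    also have "\<dots> = (\<Sum>i\<in>I. \<Sum>l\<in>UNIV. b i * real_of_int (\<tau> i l * d k l) / real_of_int D)"
      by (rule sum.swap)
    also have "\<dots> = (\<Sum>i\<in>I. b i * real_of_int (dot (\<tau> i) (d k)) / real_of_int D)"
      by (simp add: dot_def sum_divide_distrib sum_distrib_left)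
    also have "\<dots> = (\<Sum>i\<in>I. if i = k then b i else 0)"
      by (rule sum.cong) (use \<tau> k D in auto)
    finally show ?thesis using k assms by simp
  qed
  then show thesis using that by blast
qed

section \<open>Solvable systems with prescribed absolute values\<close>

text \<open>Three lengths in [1, 2] satisfy the triangle inequalities, so they are the sides of a
  possibly degenerate triangle.\<close>

lemma triangle_phases:
  fixes r s \<rho> :: real
  assumes "1 \<le> r" "r \<le> 2" "1 \<le> s" "s \<le> 2" "1 \<le> \<rho>" "\<rho> \<le> 2"
  obtains c d :: complex where "cmod c = 1" "cmod d = 1" "c * of_real r + d * of_real s = of_real \<rho>"
proof -
  \<comment> \<open>The cosine of the angle between the sides r and \<rho>, by the law of
    cosines.\<close>
  define x where "x = (r\<^sup>2 + \<rho>\<^sup>2 - s\<^sup>2) / (2 * r * \<rho>)"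
  have "(r - \<rho>)\<^sup>2 \<le> s\<^sup>2" "s\<^sup>2 \<le> (r + \<rho>)\<^sup>2"
    using assms by (auto simp: abs_le_square_iff[symmetric])
  then have "x \<le> 1" "-1 \<le> x" using assms
    by (auto simp: x_def field_simps power2_eq_square)
  define c where "c = cis (arccos x)"
  have x: "Re c = x" using \<open>x \<le> 1\<close> \<open>-1 \<le> x\<close> by (simp add: c_def)
  have "cmod c = 1" by (simp add: c_def)
  then have c2: "(Re c)\<^sup>2 + (Im c)\<^sup>2 = 1" by (simp add: cmod_def)
  have "(cmod (of_real \<rho> - c * of_real r))\<^sup>2 = \<rho>\<^sup>2 + r\<^sup>2 * ((Re c)\<^sup>2 + (Im c)\<^sup>2) - 2 * r * \<rho> * Re c"
    unfolding cmod_power2 by (simp add: power2_eq_square algebra_simps)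
  also have "\<dots> = r\<^sup>2 + \<rho>\<^sup>2 - 2 * r * \<rho> * x" unfolding c2 by (simp add: x)
  also have "\<dots> = s\<^sup>2" using assms by (simp add: x_def)
  finally have n: "cmod (of_real \<rho> - c * of_real r) = s" using assms by (simp add: power2_eq_iff_nonneg)
  show thesis
    by (rule that[OF \<open>cmod c = 1\<close>, of "(of_real \<rho> - c * of_real r) / of_real s"])
       (use n assms in \<open>auto simp: norm_divide\<close>)
qed

lemma polygon_phases_chain:
  fixes r :: "'a \<Rightarrow> real"
  assumes "finite S" "card S \<ge> 2" "\<And>a. a \<in> S \<Longrightarrow> 1 \<le> r a \<and> r a \<le> 2" "1 \<le> \<rho>" "\<rho> \<le> 2"
  shows "\<exists>\<phi>. (\<forall>a\<in>S. cmod (\<phi> a) = 1) \<and> (\<Sum>a\<in>S. \<phi> a * of_real (r a)) = of_real \<rho>"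
  using assms
proof (induction S arbitrary: \<rho> rule: finite_induct)
  case (insert b F)
  have rb: "1 \<le> r b" "r b \<le> 2" using insert.prems by auto
  \<comment> \<open>The remaining vectors are folded into one side s of a triangle. Any s in [1, 2]
    will do: two or more vectors can be made to sum to 1, and a single one has its own
    length.\<close>
  have "\<exists>\<phi> s. (\<forall>a\<in>F. cmod (\<phi> a) = 1) \<and> 1 \<le> s \<and> s \<le> 2 \<and> (\<Sum>a\<in>F. \<phi> a * of_real (r a)) = of_real s"
  proof (cases "card F \<ge> 2")
    case True
    then show ?thesis using insert.IH[of 1] insert.prems(2) by fastforce
  next
    case False
    then have "card F = 1" using insert by simp
    then obtain a where "F = {a}" by (auto simp: card_1_singleton_iff)
    then show ?thesis using insert.prems(2)[of a]
      by (intro exI[of _ "\<lambda>_. 1"] exI[of _ "r a"]) simp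
  qed
  then obtain \<phi> s where \<phi>: "\<forall>a\<in>F. cmod (\<phi> a) = 1" "1 \<le> s" "s \<le> 2"
    "(\<Sum>a\<in>F. \<phi> a * of_real (r a)) = of_real s" by blast
  obtain c d where cd: "cmod c = 1" "cmod d = 1" "c * of_real (r b) + d * of_real s = of_real \<rho>"
    using triangle_phases[OF rb \<phi>(2,3) insert.prems(3,4)] by blast
  have "(\<Sum>a\<in>F. (if a = b then c else d * \<phi> a) * of_real (r a)) = (\<Sum>a\<in>F. d * (\<phi> a * of_real (r a)))"
    by (rule sum.cong) (use insert.hyps in auto)
  also have "\<dots> = d * of_real s" by (simp add: sum_distrib_left[symmetric] \<phi>(4))
  finally show ?case using insert.hyps cd \<phi>(1)
    by (intro exI[of _ "\<lambda>a. if a = b then c else d * \<phi> a"]) (auto simp: norm_mult)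
qed simp

text \<open>One vector is set aside with phase -1, and the others are arranged to sum to its
  length.\<close>

lemma polygon_phases:
  fixes r :: "'a \<Rightarrow> real"
  assumes "finite S" "card S \<ge> 3" "\<And>a. a \<in> S \<Longrightarrow> 1 \<le> r a \<and> r a \<le> 2"
  obtains \<phi> where "\<And>a. a \<in> S \<Longrightarrow> cmod (\<phi> a) = 1" "(\<Sum>a\<in>S. \<phi> a * of_real (r a)) = 0"
proof -
  obtain b where b: "b \<in> S" using assms by fastforce
  have "card (S - {b}) \<ge> 2" using assms b by simp
  then obtain \<phi> where \<phi>: "\<forall>a\<in>S - {b}. cmod (\<phi> a) = 1"
    "(\<Sum>a\<in>S - {b}. \<phi> a * of_real (r a)) = of_real (r b)"
    using polygon_phases_chain[of "S - {b}" r "r b"] assms b by auto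
  have "(\<Sum>a\<in>S. (if a = b then -1 else \<phi> a) * of_real (r a)) =
     - of_real (r b) + (\<Sum>a\<in>S - {b}. (if a = b then -1 else \<phi> a) * of_real (r a))"
    using assms b by (subst sum.remove[of S b]) auto
  also have "(\<Sum>a\<in>S - {b}. (if a = b then -1 else \<phi> a) * of_real (r a)) = of_real (r b)"
    unfolding \<phi>(2)[symmetric] by (rule sum.cong) auto
  finally show thesis using \<phi>(1) by (intro that[of "\<lambda>a. if a = b then -1 else \<phi> a"]) auto
qed


section \<open>Supports with two points\<close>

lemma power_int_prod: "(\<Prod>i\<in>I. f i :: complex) powi k = (\<Prod>i\<in>I. f i powi k)"
  by (induction I rule: infinite_finite_induct) (simp_all add: power_int_mult_distrib)

locale support_family =
  fixes A :: "nat \<Rightarrow> (int ^ 'n::finite) set" and x :: "nat \<Rightarrow> int ^ 'n \<Rightarrow> 'v::finite"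
  assumes fin: "\<And>i. i \<le> CARD('n) \<Longrightarrow> finite (A i)"
    and bij: "bij_betw (\<lambda>(i, a). x i a) (SIGMA i:{..CARD('n)}. A i) UNIV"
    and card_ne_1: "\<And>i. i \<le> CARD('n) \<Longrightarrow> card (A i) \<noteq> 1"
begin

definition index :: "'v \<Rightarrow> nat \<times> (int ^ 'n)" where
  "index = inv_into (SIGMA i:{..CARD('n)}. A i) (\<lambda>(i, a). x i a)"

lemma index_x: "i \<le> CARD('n) \<Longrightarrow> a \<in> A i \<Longrightarrow> index (x i a) = (i, a)"
  unfolding index_def
  using inv_into_f_f[of "\<lambda>(i, a). x i a" "SIGMA i:{..CARD('n)}. A i" "(i, a)"] bij
  by (simp add: bij_betw_def)

lemma variable_cases:
  obtains i a where "i \<le> CARD('n)" "a \<in> A i" "v = x i a"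
proof -
  have "v \<in> (\<lambda>(i, a). x i a) ` (SIGMA i:{..CARD('n)}. A i)" using bij by (simp add: bij_betw_def)
  then show thesis using that by auto
qed

lemma sum_variables:
  fixes f :: "'v \<Rightarrow> 'b::comm_monoid_add"
  shows "(\<Sum>v\<in>UNIV. f v) = (\<Sum>i\<le>CARD('n). \<Sum>a\<in>A i. f (x i a))"
proof -
  have "(\<Sum>v\<in>UNIV. f v) = (\<Sum>(i, a)\<in>(SIGMA i:{..CARD('n)}. A i). f (x i a))"
    by (subst sum.reindex_bij_betw[OF bij, symmetric]) (simp add: case_prod_beta')
  also have "\<dots> = (\<Sum>i\<le>CARD('n). \<Sum>a\<in>A i. f (x i a))"
    by (subst sum.Sigma) (use fin in auto)
  finally show ?thesis .
qed

lemma prod_variables: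
  fixes f :: "'v \<Rightarrow> 'b::comm_monoid_mult"
  shows "(\<Prod>v\<in>UNIV. f v) = (\<Prod>i\<le>CARD('n). \<Prod>a\<in>A i. f (x i a))"
proof -
  have "(\<Prod>v\<in>UNIV. f v) = (\<Prod>(i, a)\<in>(SIGMA i:{..CARD('n)}. A i). f (x i a))"
    by (subst prod.reindex_bij_betw[OF bij, symmetric]) (simp add: case_prod_beta')
  also have "\<dots> = (\<Prod>i\<le>CARD('n). \<Prod>a\<in>A i. f (x i a))"
    by (subst prod.Sigma) (use fin in auto)
  finally show ?thesis .
qed

section \<open>Two-point supports as oriented edges\<close>

definition edges :: "nat set" where
  "edges = {i. i \<le> CARD('n) \<and> card (A i) = 2}"

text \<open>The choice of this point orients an edge arbitrarily. It also serves as the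
  distinguished point of larger supports.\<close>

definition src :: "nat \<Rightarrow> int ^ 'n" where
  "src i = (SOME p. p \<in> A i)"

definition tgt :: "nat \<Rightarrow> int ^ 'n" where
  "tgt i = (SOME q. q \<in> A i - {src i})"

lemma finite_edges: "finite edges"
  by (simp add: edges_def)

lemma edge:
  assumes "i \<in> edges"
  shows "A i = {src i, tgt i}" "src i \<noteq> tgt i"
proof -
  obtain p q where pq: "A i = {p, q}" "p \<noteq> q"
    using assms by (auto simp: edges_def card_2_iff)
  have s: "src i \<in> A i" unfolding src_def by (rule someI[of _ p]) (simp add: pq)
  have "\<exists>q. q \<in> A i - {src i}" using pq by (cases "src i = p") auto
  then have "tgt i \<in> A i - {src i}" unfolding tgt_def by (rule someI_ex)
  then have t: "tgt i \<in> {p, q}" and "tgt i \<noteq> src i" using pq(1) by blast+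
  moreover have "src i = p \<or> src i = q" "tgt i = p \<or> tgt i = q" using s t pq(1) by simp_all
  ultimately have "A i = {src i, tgt i} \<and> src i \<noteq> tgt i" using pq by (metis insert_commute)
  then show "A i = {src i, tgt i}" "src i \<noteq> tgt i" by simp_all
qed

text \<open>Scaling all lengths by exp (e * M) brings them into [1, 2], where three or more of them
  close up; on an edge the two lengths agree and opposite signs suffice.\<close>

lemma phases_near_1:
  assumes i: "i \<le> CARD('n)" and s: "\<And>a. a \<in> A i \<Longrightarrow> \<bar>s a\<bar> \<le> M"
    and edge_eq: "i \<in> edges \<Longrightarrow> s (src i) = s (tgt i)"
    and e: "0 < e" "2 * e * M \<le> ln 2"
  shows "\<exists>\<phi>. (\<forall>a\<in>A i. cmod (\<phi> a) = 1) \<and> (\<Sum>a\<in>A i. \<phi> a * of_real (exp (e * s a))) = 0"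
proof -
  consider "A i = {}" | "i \<in> edges" | "card (A i) \<ge> 3"
    using card_ne_1[OF i] fin[OF i] i unfolding edges_def
    by (metis (mono_tags, lifting) One_nat_def Suc_1 card_0_eq le_antisym mem_Collect_eq
        not_less_eq_eq numeral_3_eq_3 le_zero_eq)
  then show ?thesis
  proof cases
    case 2
    then show ?thesis using edge[OF 2] edge_eq
      by (intro exI[of _ "\<lambda>a. if a = src i then 1 else -1"]) auto
  next
    case 3
    define r where "r a = exp (e * s a + e * M)" for a
    have "1 \<le> r a \<and> r a \<le> 2" if "a \<in> A i" for a
    proof -
      have "s a + M \<ge> 0" "s a \<le> M" using s[OF that] by auto
      then have "0 \<le> e * (s a + M)" and le: "e * s a \<le> e * M" using e by auto
      moreover have "e * s a + e * M \<le> ln 2" using le e(2) unfolding mult.assoc by linarith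
      ultimately have "0 \<le> e * s a + e * M" "e * s a + e * M \<le> ln 2" by (simp_all add: distrib_left)
      then show ?thesis unfolding r_def by (metis exp_le_cancel_iff exp_ln exp_zero zero_less_numeral)
    qed
    then obtain \<phi> where \<phi>: "\<And>a. a \<in> A i \<Longrightarrow> cmod (\<phi> a) = 1" "(\<Sum>a\<in>A i. \<phi> a * of_real (r a)) = 0"
      using polygon_phases[OF fin[OF i] 3] by metis
    have "(\<Sum>a\<in>A i. \<phi> a * of_real (exp (e * s a))) * of_real (exp (e * M)) = 0"
      using \<phi>(2) by (simp add: r_def exp_add sum_distrib_right mult.assoc)
    then show ?thesis using \<phi>(1) by auto
  qed auto
qed

lemma solvable_with_absolute_values:
  assumes indep: "\<And>\<nu>. (\<And>l. (\<Sum>i\<in>edges. \<nu> i * (src i $ l - tgt i $ l)) = 0) \<Longrightarrow> \<forall>i\<in>edges. \<nu> i = 0"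
  shows "\<exists>e\<^sub>0>0. \<forall>e. 0 < e \<and> e < e\<^sub>0 \<longrightarrow>
    (\<exists>c\<in>solvable_systems A x. \<forall>v. cmod (c $ v) = exp (e * u v))"
proof -
  \<comment> \<open>With t = exp (e * \<tau>) coordinatewise, the terms have sizes exp (e * s). The
    equations for \<tau> say that s takes equal values at both ends of every edge.\<close>
  obtain \<tau> :: "'n \<Rightarrow> real" where \<tau>: "\<And>i. i \<in> edges \<Longrightarrow>
    (\<Sum>l\<in>UNIV. \<tau> l * real_of_int (src i $ l - tgt i $ l)) = u (x i (tgt i)) - u (x i (src i))"
    by (rule independent_solvable[of edges "\<lambda>i l. src i $ l - tgt i $ l"
          "\<lambda>i. u (x i (tgt i)) - u (x i (src i))"]) (use finite_edges indep in auto)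
  define h where "h a = (\<Sum>l\<in>UNIV. \<tau> l * real_of_int (a $ l))" for a :: "int ^ 'n"
  define s where "s i a = u (x i a) + h a" for i a
  \<comment> \<open>The summand 1 keeps M positive, so that the bound ln 2 / (2 * M) on e is
    meaningful and positive.\<close>
  define M where "M = 1 + (\<Sum>i\<le>CARD('n). \<Sum>a\<in>A i. \<bar>s i a\<bar>)"
  have "M \<ge> 1" unfolding M_def by (simp add: sum_nonneg)
  have M: "\<bar>s i a\<bar> \<le> M" if "i \<le> CARD('n)" "a \<in> A i" for i a
  proof -
    have "\<bar>s i a\<bar> \<le> (\<Sum>a\<in>A i. \<bar>s i a\<bar>)"
      using that fin by (intro member_le_sum) auto
    also have "\<dots> \<le> (\<Sum>i\<le>CARD('n). \<Sum>a\<in>A i. \<bar>s i a\<bar>)"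
      using that by (intro member_le_sum[of i _ "\<lambda>i. \<Sum>a\<in>A i. \<bar>s i a\<bar>"]) (auto intro: sum_nonneg)
    finally show ?thesis by (simp add: M_def)
  qed
  have s_edge: "s i (src i) = s i (tgt i)" if "i \<in> edges" for i
    using \<tau>[OF that] by (simp add: s_def h_def right_diff_distrib sum_subtractf)
  have "\<exists>c\<in>solvable_systems A x. \<forall>v. cmod (c $ v) = exp (e * u v)"
    if e: "0 < e" "e < ln 2 / (2 * M)" for e
  proof -
    have eM: "2 * e * M \<le> ln 2" using e \<open>M \<ge> 1\<close> by (simp add: field_simps)
    have "\<forall>i\<in>{..CARD('n)}. \<exists>\<phi>. (\<forall>a\<in>A i. cmod (\<phi> a) = 1) \<and>
        (\<Sum>a\<in>A i. \<phi> a * of_real (exp (e * s i a))) = 0"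
      by (rule ballI, rule phases_near_1[where M = M]) (use M s_edge e(1) eM in auto)
    from bchoice[OF this] obtain \<phi> where \<phi>: "\<And>i a. i \<le> CARD('n) \<Longrightarrow> a \<in> A i \<Longrightarrow> cmod (\<phi> i a) = 1"
      "\<And>i. i \<le> CARD('n) \<Longrightarrow> (\<Sum>a\<in>A i. \<phi> i a * of_real (exp (e * s i a))) = 0" by auto
    define c :: "complex ^ 'v" where
      "c = (\<chi> v. case index v of (i, a) \<Rightarrow> \<phi> i a * of_real (exp (e * u v)))"
    define t :: "complex ^ 'n" where "t = (\<chi> l. of_real (exp (e * \<tau> l)))"
    have c: "c $ x i a = \<phi> i a * of_real (exp (e * u (x i a)))" if "i \<le> CARD('n)" "a \<in> A i" for i a
      by (simp add: c_def index_x that)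
    have t: "laurent_monomial a t = of_real (exp (e * h a))" for a
      unfolding laurent_monomial_def t_def
      by (simp add: exp_power_int of_real_power_int[symmetric] of_real_prod[symmetric] exp_sum[symmetric]
          h_def sum_distrib_left mult_ac del: of_real_power_int of_real_prod)
    have "specialized_system A x c i t = 0" if i: "i \<le> CARD('n)" for i
    proof -
      have "specialized_system A x c i t = (\<Sum>a\<in>A i. \<phi> i a * of_real (exp (e * s i a)))"
        unfolding specialized_system_def
        by (rule sum.cong) (simp_all add: c i t s_def distrib_left exp_add mult.assoc)
      then show ?thesis using \<phi>(2)[OF i] by simp
    qed
    moreover have "t $ l \<noteq> 0" for l by (simp add: t_def)
    ultimately have "c \<in> solvable_systems A x" unfolding solvable_systems_def by blast
    moreover have "cmod (c $ v) = exp (e * u v)" for v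
      by (rule variable_cases[of v]) (simp add: c \<phi>(1) norm_mult)
    ultimately show ?thesis by blast
  qed
  moreover have "ln 2 / (2 * M) > 0" using \<open>M \<ge> 1\<close> by simp
  ultimately show ?thesis by blast
qed

text \<open>At t = 1 an equation says that its coefficients sum to 0. All are 1 except one, which is
  1 minus the number of terms and hence nonzero, as no support is a singleton.\<close>

lemma torus_solvable:
  obtains c where "c \<in> solvable_systems A x" "torus_pt c"
proof -
  define c :: "complex ^ 'v" where
    "c = (\<chi> v. case index v of (i, a) \<Rightarrow> if a = src i then - of_nat (card (A i) - 1) else 1)"
  have src: "src i \<in> A i" if "a \<in> A i" for i a
    unfolding src_def using that by (rule someI)
  have "(\<Sum>a\<in>A i. c $ x i a) = 0" if i: "i \<le> CARD('n)" for i
  proof (cases "A i = {}")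
    case False
    then have s: "src i \<in> A i" using src by blast
    have "(\<Sum>a\<in>A i. c $ x i a) = c $ x i (src i) + (\<Sum>a\<in>A i - {src i}. c $ x i a)"
      by (rule sum.remove[OF fin[OF i] s])
    also have "(\<Sum>a\<in>A i - {src i}. c $ x i a) = (\<Sum>a\<in>A i - {src i}. 1)"
      by (rule sum.cong) (auto simp: c_def index_x i)
    finally show ?thesis using s by (simp add: c_def index_x i)
  qed simp
  then have "c \<in> solvable_systems A x"
    unfolding solvable_systems_def specialized_system_def laurent_monomial_def
    by (intro CollectI exI[of _ 1]) simp
  moreover have "torus_pt c" unfolding torus_pt_def
  proof
    fix v show "c $ v \<noteq> 0"
    proof (rule variable_cases[of v])
      fix i a assume ia: "i \<le> CARD('n)" "a \<in> A i" "v = x i a"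
      then have "card (A i) \<noteq> 0" using fin by auto
      then have "card (A i) - 1 \<noteq> 0" using card_ne_1[OF ia(1)] by simp
      then show ?thesis using ia by (simp add: c_def index_x)
    qed
  qed
  ultimately show thesis using that by blast
qed

text \<open>On an edge the ratio of the two coefficients is minus the Laurent monomial with exponent
  \<open>tgt i - src i\<close>. Multiplying these ratios with exponents \<nu>' i cancels t by the
  relation and leaves a character equal to a sign.\<close>

lemma resultant_of_dependent_edges:
  assumes rel: "\<And>l. (\<Sum>i\<in>edges. \<nu> i * (src i $ l - tgt i $ l)) = 0" and nz: "\<exists>i\<in>edges. \<nu> i \<noteq> 0"
    and hyp: "is_hypersurface (zariski_closure (solvable_systems A x))"
    and irr: "irreducible R" and van: "\<And>c. c \<in> solvable_systems A x \<Longrightarrow> int_eval c R = 0"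
  obtains \<alpha> \<beta> where "\<alpha> \<noteq> \<beta>" "Poly_Mapping.keys R = {\<alpha>, \<beta>}"
    "\<bar>Poly_Mapping.lookup R \<alpha>\<bar> = 1" "\<bar>Poly_Mapping.lookup R \<beta>\<bar> = 1"
proof -
  obtain w \<nu>' g where g: "g > 0" "\<And>i. i \<in> edges \<Longrightarrow> \<nu> i = g * \<nu>' i" and w: "(\<Sum>i\<in>edges. w i * \<nu>' i) = 1"
    using bezout_family[OF finite_edges nz] by metis
  have rel': "(\<Sum>i\<in>edges. \<nu>' i * (src i $ l - tgt i $ l)) = 0" for l
  proof -
    have "g * (\<Sum>i\<in>edges. \<nu>' i * (src i $ l - tgt i $ l)) = 0"
      using rel[of l] g(2) by (simp add: sum_distrib_left mult.assoc)
    then show ?thesis using g(1) by simp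
  qed
  \<comment> \<open>The exponents of the product of the coefficient ratios. The vector
    \<open>u\<^sub>0\<close> below puts the Bezout coefficients on the sources alone, so its pairing
    with \<mu> is the Bezout sum 1.\<close>
  define \<mu> where "\<mu> v = (case index v of (i, a) \<Rightarrow>
    if i \<in> edges then (if a = src i then \<nu>' i else - \<nu>' i) else 0)" for v
  define u\<^sub>0 where "u\<^sub>0 v = (case index v of (i, a) \<Rightarrow>
    if i \<in> edges \<and> a = src i then w i else 0)" for v
  \<comment> \<open>One factor (-1)^(\<nu>' i) per edge; the absolute value makes the exponent
    natural without changing its parity.\<close>
  define e :: int where "e = (\<Prod>i\<in>edges. (-1) ^ nat \<bar>\<nu>' i\<bar>)"
  have le: "i \<le> CARD('n)" if "i \<in> edges" for i using that by (simp add: edges_def)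
  have mem: "src i \<in> A i" "tgt i \<in> A i" if "i \<in> edges" for i using edge[OF that] by auto
  have \<mu>_src: "\<mu> (x i (src i)) = \<nu>' i" and \<mu>_tgt: "\<mu> (x i (tgt i)) = - \<nu>' i"
    and u_src: "u\<^sub>0 (x i (src i)) = w i" and u_tgt: "u\<^sub>0 (x i (tgt i)) = 0" if "i \<in> edges" for i
    using that edge(2)[OF that] by (auto simp: \<mu>_def u\<^sub>0_def index_x le mem)
  have \<mu>_0: "\<mu> (x i a) = 0" if "i \<le> CARD('n)" "a \<in> A i" "i \<notin> edges" for i a
    using that by (simp add: \<mu>_def index_x)
  have edges_sub: "edges \<subseteq> {..CARD('n)}" using le by auto
  have "dot u\<^sub>0 \<mu> = (\<Sum>i\<le>CARD('n). \<Sum>a\<in>A i. u\<^sub>0 (x i a) * \<mu> (x i a))"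
    unfolding dot_def by (rule sum_variables)
  also have "\<dots> = (\<Sum>i\<in>edges. \<Sum>a\<in>A i. u\<^sub>0 (x i a) * \<mu> (x i a))"
    by (rule sum.mono_neutral_right) (use edges_sub \<mu>_0 in auto)
  also have "\<dots> = (\<Sum>i\<in>edges. w i * \<nu>' i)"
    by (rule sum.cong) (simp_all add: edge \<mu>_src \<mu>_tgt u_src u_tgt)
  finally have dot: "dot u\<^sub>0 \<mu> = 1" using w by simp
  have "\<exists>v. \<mu> v > 0"
  proof -
    obtain i where i: "i \<in> edges" "\<nu> i \<noteq> 0" using nz by blast
    then have "\<nu>' i > 0 \<or> - \<nu>' i > 0" using g by (cases "\<nu>' i = 0") auto
    then show ?thesis using \<mu>_src[OF i(1)] \<mu>_tgt[OF i(1)] by metis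
  qed
  then obtain v where v: "\<mu> v > 0" by blast
  have "\<bar>e\<bar> = 1" by (simp add: e_def abs_prod power_abs)
  have char: "character \<mu> c = of_int e" if c: "c \<in> solvable_systems A x" "torus_pt c" for c
  proof -
    obtain t where t: "\<And>l. t $ l \<noteq> 0" "\<And>i. i \<le> CARD('n) \<Longrightarrow> specialized_system A x c i t = 0"
      using c(1) by (auto simp: solvable_systems_def)
    have c0: "c $ v \<noteq> 0" for v using c(2) by (simp add: torus_pt_def)
    have factor: "(\<Prod>a\<in>A i. (c $ x i a) powi \<mu> (x i a)) =
        (-1) ^ nat \<bar>\<nu>' i\<bar> * (\<Prod>l\<in>UNIV. (t $ l) powi (- (\<nu>' i * (src i $ l - tgt i $ l))))"
      if i: "i \<in> edges" for i
    proof -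
      let ?p = "c $ x i (src i)" and ?q = "c $ x i (tgt i)"
      let ?P = "laurent_monomial (src i) t" and ?Q = "laurent_monomial (tgt i) t"
      have PQ: "?P \<noteq> 0" "?Q \<noteq> 0" using t(1) by (auto simp: laurent_monomial_def)
      have "?p * ?P + ?q * ?Q = 0"
        using t(2)[OF le[OF i]] edge[OF i] by (simp add: specialized_system_def)
      then have pq: "?p / ?q = (-1) * (?Q / ?P)"
        using PQ c0 by (simp add: field_simps add_eq_0_iff)
      have "(\<Prod>a\<in>A i. (c $ x i a) powi \<mu> (x i a)) = ?p powi \<nu>' i * ?q powi (- \<nu>' i)"
        using edge[OF i] by (simp add: \<mu>_src \<mu>_tgt i)
      also have "\<dots> = (?p / ?q) powi \<nu>' i"
        by (simp add: power_int_minus divide_inverse power_int_mult_distrib power_int_inverse)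
      also have "\<dots> = (-1) powi \<nu>' i * (?Q / ?P) powi \<nu>' i"
        unfolding pq by (rule power_int_mult_distrib)
      also have "(-1 :: complex) powi \<nu>' i = (-1) ^ nat \<bar>\<nu>' i\<bar>"
        by (cases "\<nu>' i \<ge> 0") (simp_all add: power_int_def power_inverse)
      also have "?Q / ?P = (\<Prod>l\<in>UNIV. (t $ l) powi (tgt i $ l - src i $ l))"
        unfolding laurent_monomial_def prod_dividef[symmetric]
        by (rule prod.cong) (simp_all add: power_int_diff t(1))
      also have "\<dots> powi \<nu>' i = (\<Prod>l\<in>UNIV. (t $ l) powi (- (\<nu>' i * (src i $ l - tgt i $ l))))"
        unfolding power_int_prod
        by (simp add: power_int_mult[symmetric] algebra_simps)
      finally show ?thesis .
    qed
    have "character \<mu> c = (\<Prod>i\<le>CARD('n). \<Prod>a\<in>A i. (c $ x i a) powi \<mu> (x i a))"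
      unfolding character_def by (rule prod_variables)
    also have "\<dots> = (\<Prod>i\<in>edges. \<Prod>a\<in>A i. (c $ x i a) powi \<mu> (x i a))"
      by (rule prod.mono_neutral_right) (use edges_sub \<mu>_0 in auto)
    also have "\<dots> = of_int e * (\<Prod>i\<in>edges. \<Prod>l\<in>UNIV. (t $ l) powi (- (\<nu>' i * (src i $ l - tgt i $ l))))"
      by (simp add: factor prod.distrib e_def)
    also have "(\<Prod>i\<in>edges. \<Prod>l\<in>UNIV. (t $ l) powi (- (\<nu>' i * (src i $ l - tgt i $ l)))) =
        (\<Prod>l\<in>UNIV. \<Prod>i\<in>edges. (t $ l) powi (- (\<nu>' i * (src i $ l - tgt i $ l))))"
      by (rule prod.swap)
    also have "\<dots> = (\<Prod>l\<in>UNIV. (t $ l) powi (\<Sum>i\<in>edges. - (\<nu>' i * (src i $ l - tgt i $ l))))"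
      by (rule prod.cong[OF refl], rule power_int_sum[symmetric, OF t(1)])
    also have "\<dots> = 1" by (simp only: sum_negf rel') simp
    finally show ?thesis by simp
  qed
  obtain c\<^sub>0 where c\<^sub>0: "c\<^sub>0 \<in> solvable_systems A x" "torus_pt c\<^sub>0" by (rule torus_solvable)
  show thesis
    by (rule irreducible_vanishing_on_coset[OF v dot \<open>\<bar>e\<bar> = 1\<close> char c\<^sub>0 hyp irr van that])
qed

end


section \<open>Jensen's formula for polynomials\<close>

abbreviation circle_measure :: "real measure" where
  "circle_measure \<equiv> restrict_space lborel {0..2 * pi}"

lemma finite_circle_measure: "finite_measure circle_measure"
  by (rule finite_measureI) (simp add: emeasure_restrict_space space_restrict_space)

lemma measure_circle: "measure circle_measure (space circle_measure) = 2 * pi"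
  by (simp add: measure_restrict_space space_restrict_space)

lemma circle_continuous:
  fixes f :: "real \<Rightarrow> real"
  assumes "continuous_on {0..2 * pi} f"
  shows "integrable circle_measure f" "integral\<^sup>L circle_measure f = integral {0..2 * pi} f"
proof -
  have s: "set_integrable lborel {0..2 * pi} f" by (rule borel_integrable_atLeastAtMost'[OF assms])
  then show "integrable circle_measure f"
    by (simp add: set_integrable_def integrable_restrict_space)
  have "integral\<^sup>L circle_measure f = (LINT x:{0..2 * pi}|lborel. f x)"
    by (simp add: integral_restrict_space set_lebesgue_integral_def)
  then show "integral\<^sup>L circle_measure f = integral {0..2 * pi} f"
    using set_borel_integral_eq_integral(2)[OF s] by simp
qed

text \<open>Cauchy's formula at the centre for the function Ln (1 - b z), whose value there is 0.
  The argument 1 - b z stays in the right half-plane, so the principal branch is holomorphic on the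
  closed disc.\<close>

lemma mean_value_log:
  assumes b: "cmod b < 1"
  shows "((\<lambda>\<phi>. ln (cmod (1 - b * cis \<phi>))) has_integral 0) {0..2 * pi}"
proof -
  have small: "cmod (b * z) < 1" if "cmod z \<le> 1" for z
    using mult_left_le[OF that, of "cmod b"] b by (simp add: norm_mult)
  have Re: "Re (1 - b * z) > 0" if "cmod z \<le> 1" for z
    using small[OF that] complex_Re_le_cmod[of "b * z"] by simp
  have "(\<lambda>z. Ln (1 - b * z)) holomorphic_on cball 0 1"
    by (intro holomorphic_intros) (use Re complex_nonpos_Reals_iff in force)
  from Cauchy_integral_circlepath_simple[OF this, of 0]
  have "((\<lambda>u. Ln (1 - b * u) / u) has_contour_integral 0) (circlepath 0 1)" by simp
  then have "((\<lambda>x. Ln (1 - b * circlepath 0 1 x) / circlepath 0 1 x *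
      vector_derivative (circlepath 0 1) (at x within {0..1})) has_integral 0) {0..1}"
    unfolding has_contour_integral_def .
  then have "((\<lambda>x. 2 * pi * \<i> * Ln (1 - b * cis (2 * pi * x))) has_integral 0) {0..1}"
  proof (rule has_integral_eq[rotated])
    fix x :: real assume x: "x \<in> {0..1}"
    have cp: "circlepath 0 1 x = cis (2 * pi * x)" by (simp add: circlepath cis_conv_exp mult_ac)
    have vd: "vector_derivative (circlepath 0 1) (at x within {0..1}) = 2 * pi * \<i> * cis (2 * pi * x)"
      using vector_derivative_circlepath01[of x 0 1] x by (simp add: cis_conv_exp mult_ac)
    show "Ln (1 - b * circlepath 0 1 x) / circlepath 0 1 x *
      vector_derivative (circlepath 0 1) (at x within {0..1}) = 2 * pi * \<i> * Ln (1 - b * cis (2 * pi * x))"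
      unfolding vd cp by simp
  qed
  from has_integral_mult_right[OF this, of "1 / (2 * pi * \<i>)"]
  have "((\<lambda>x. Ln (1 - b * cis (2 * pi * x))) has_integral 0) {0..1}" by simp
  from has_integral_Re[OF this]
  have "((\<lambda>x. Re (Ln (1 - b * cis (2 * pi * x)))) has_integral 0) {0..1}" by simp
  then have "((\<lambda>x. ln (cmod (1 - b * cis (2 * pi * x)))) has_integral 0) {0..1}"
  proof (rule has_integral_eq[rotated])
    fix x
    have "1 - b * cis (2 * pi * x) \<noteq> 0" using Re[of "cis (2 * pi * x)"] by force
    then show "Re (Ln (1 - b * cis (2 * pi * x))) = ln (cmod (1 - b * cis (2 * pi * x)))" by simp
  qed
  then have "((\<lambda>x. ln (cmod (1 - b * cis (2 * pi * x)))) has_integral 0) (cbox 0 1)" by simp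
  from has_integral_affinity'[OF this, of "1 / (2 * pi)" 0] show ?thesis by simp
qed

text \<open>The function log^+ of Jensen's formula.\<close>

definition ln_max1 :: "real \<Rightarrow> real" where
  "ln_max1 y = ln (max 1 y)"

lemma ln_max1_nonneg: "ln_max1 y \<ge> 0"
  by (simp add: ln_max1_def)

text \<open>Inside the disc the distance equals |1 - cnj a cis \<phi>|, by conjugation and a
  rotation; outside, the factor -a is taken out and contributes ln |a|.\<close>

lemma mean_log_dist_off_circle:
  assumes a: "cmod a \<noteq> 1"
  shows "integrable circle_measure (\<lambda>\<phi>. ln (cmod (cis \<phi> - a)))"
    "(LINT \<phi>|circle_measure. ln (cmod (cis \<phi> - a))) = 2 * pi * ln_max1 (cmod a)"
proof -
  have nz: "cis \<phi> - a \<noteq> 0" for \<phi> using a by auto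
  have cont: "continuous_on {0..2 * pi} (\<lambda>\<phi>. ln (cmod (cis \<phi> - a)))"
    by (intro continuous_intros) (use nz in auto)
  show "integrable circle_measure (\<lambda>\<phi>. ln (cmod (cis \<phi> - a)))" by (rule circle_continuous(1)[OF cont])
  have "((\<lambda>\<phi>. ln (cmod (cis \<phi> - a))) has_integral 2 * pi * ln_max1 (cmod a)) {0..2 * pi}"
  proof (cases "cmod a < 1")
    case True
    have "cmod (1 - cnj a * cis \<phi>) = cmod (cis \<phi> - a)" for \<phi>
    proof -
      have "cis \<phi> * cnj (1 - cnj a * cis \<phi>) = cis \<phi> - a"
        by (simp add: right_diff_distrib cis_cnj mult.left_commute flip: cis_mult) (simp add: cis_mult)
      then have "cmod (cis \<phi> - a) = cmod (cis \<phi> * cnj (1 - cnj a * cis \<phi>))" by simp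
      then show ?thesis by (simp only: norm_mult norm_cis complex_mod_cnj mult_1)
    qed
    then show ?thesis using mean_value_log[of "cnj a"] True by (simp add: ln_max1_def)
  next
    case False
    then have gt: "cmod a > 1" using a by simp
    then have "a \<noteq> 0" by auto
    have "cmod (1 / a) < 1" using gt by (simp add: norm_divide divide_less_eq)
    from has_integral_add[OF mean_value_log[OF this] has_integral_const_real[of "ln (cmod a)" 0 "2 * pi"]]
    have "((\<lambda>\<phi>. ln (cmod (1 - 1 / a * cis \<phi>)) + ln (cmod a)) has_integral 2 * pi * ln (cmod a)) {0..2 * pi}"
      by simp
    moreover have "ln (cmod (1 - 1 / a * cis \<phi>)) + ln (cmod a) = ln (cmod (cis \<phi> - a))" for \<phi>
    proof -
      have eq: "cis \<phi> - a = - a * (1 - 1 / a * cis \<phi>)" using \<open>a \<noteq> 0\<close> by (simp add: field_simps)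
      then have "1 - 1 / a * cis \<phi> \<noteq> 0" using nz[of \<phi>] by auto
      then show ?thesis unfolding eq norm_mult norm_minus_cancel using \<open>a \<noteq> 0\<close> by (simp add: ln_mult)
    qed
    ultimately show ?thesis using gt by (simp add: ln_max1_def)
  qed
  then show "(LINT \<phi>|circle_measure. ln (cmod (cis \<phi> - a))) = 2 * pi * ln_max1 (cmod a)"
    using circle_continuous(2)[OF cont] by (simp add: integral_unique)
qed

lemma AE_cis_neq: "AE \<phi> in circle_measure. cis \<phi> \<noteq> a"
proof -
  have "countable {\<phi>. cis \<phi> = a}"
  proof (cases "\<exists>\<psi>. cis \<psi> = a")
    case True
    then obtain \<psi> where \<psi>: "cis \<psi> = a" by blast
    have "{\<phi>. cis \<phi> = a} \<subseteq> range (\<lambda>k::int. \<psi> + 2 * pi * of_int k)"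
    proof
      fix \<phi> assume "\<phi> \<in> {\<phi>. cis \<phi> = a}"
      then have "sin \<phi> = sin \<psi> \<and> cos \<phi> = cos \<psi>" using \<psi> by (auto simp: complex_eq_iff)
      then show "\<phi> \<in> range (\<lambda>k::int. \<psi> + 2 * pi * of_int k)"
        unfolding sin_cos_eq_iff by auto
    qed
    then show ?thesis by (rule countable_subset) auto
  qed simp
  then have "{\<phi>. cis \<phi> = a} \<in> null_sets lborel" by (rule countable_imp_null_set_lborel)
  then have "AE \<phi> in lborel. cis \<phi> \<noteq> a" by (rule AE_I') auto
  then have "AE \<phi> in lborel. \<phi> \<in> {0..2 * pi} \<longrightarrow> cis \<phi> \<noteq> a" by eventually_elim simp
  then show ?thesis by (subst AE_restrict_space_iff) auto
qed

lemma measurable_ln_dist [measurable]: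
  "(\<lambda>\<phi>. ln (cmod (cis \<phi> - a))) \<in> borel_measurable circle_measure"
proof -
  have "(\<lambda>\<phi>. cmod (cis \<phi> - a)) \<in> borel_measurable borel"
    by (intro borel_measurable_continuous_onI continuous_intros)
  then have "(\<lambda>\<phi>. ln (cmod (cis \<phi> - a))) \<in> borel_measurable lborel" by simp
  then show ?thesis by (rule measurable_restrict_space1)
qed

text \<open>On the unit circle, Fatou's lemma gives integrability and dominated convergence the value, both
  along the radius towards \<open>a\<close>.\<close>

lemma mean_log_dist_on_circle:
  assumes a: "cmod a = 1"
  shows "integrable circle_measure (\<lambda>\<phi>. ln (cmod (cis \<phi> - a)))"
    "(LINT \<phi>|circle_measure. ln (cmod (cis \<phi> - a))) = 0"
proof -
  interpret finite_measure circle_measure by (rule finite_circle_measure)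
  \<comment> \<open>The offset 2 keeps r strictly between 0 and 1 already at n = 0.\<close>
  define r where "r n = 1 - 1 / (real n + 2)" for n
  have r: "0 < r n" "r n < 1" for n by (auto simp: r_def field_simps)
  have "(\<lambda>n. 1 / (real n + 2)) \<longlonglongrightarrow> 0"
    using LIMSEQ_ignore_initial_segment[OF lim_1_over_n[where 'a = real], of 2] by (simp add: add.commute)
  then have "r \<longlonglongrightarrow> 1 - 0" unfolding r_def by (intro tendsto_intros)
  then have r1: "r \<longlonglongrightarrow> 1" by simp
  define h where "h \<phi> = ln (cmod (cis \<phi> - a))" for \<phi>
  define hn where "hn n \<phi> = ln (cmod (cis \<phi> - of_real (r n) * a))" for n \<phi>
  have [measurable]: "h \<in> borel_measurable circle_measure" "hn n \<in> borel_measurable circle_measure" for n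
    unfolding h_def hn_def by measurable
  have ra: "cmod (of_real (r n) * a) = r n" for n using r[of n] a by (simp add: norm_mult)
  have hn_int: "integrable circle_measure (hn n)" "integral\<^sup>L circle_measure (hn n) = 0" for n
    using mean_log_dist_off_circle[of "of_real (r n) * a"] ra[of n] r[of n]
    by (simp_all add: hn_def[abs_def] ln_max1_def)
  have pos: "0 < cmod (cis \<phi> - of_real (r n) * a)" for n \<phi>
  proof -
    have "cis \<phi> \<noteq> of_real (r n) * a" using ra[of n] r[of n] norm_cis[of \<phi>] by (metis less_irrefl)
    then show ?thesis by simp
  qed
  \<comment> \<open>Distances within the closed unit disc are at most 2, so ln 2 - h and ln 2 - hn
    are nonnegative and \<open>ennreal\<close> truncates nothing.\<close>
  have le2: "ln y \<le> ln 2" if "0 \<le> y" "y \<le> 2" for y :: real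
    using that by (cases "y = 0") auto
  have h2: "h \<phi> \<le> ln 2" for \<phi> unfolding h_def
    by (rule le2) (use norm_triangle_ineq4[of "cis \<phi>" a] a in auto)
  have hn2: "hn n \<phi> \<le> ln 2" for n \<phi> unfolding hn_def
    by (rule le2) (use norm_triangle_ineq4[of "cis \<phi>" "of_real (r n) * a"] ra[of n] r[of n] in auto)
  have lim: "AE \<phi> in circle_measure. (\<lambda>n. hn n \<phi>) \<longlonglongrightarrow> h \<phi>"
    using AE_cis_neq[of a]
  proof eventually_elim
    case (elim \<phi>)
    have "(\<lambda>n. ln (cmod (cis \<phi> - of_real (r n) * a))) \<longlonglongrightarrow> ln (cmod (cis \<phi> - of_real 1 * a))"
      by (intro tendsto_intros r1) (use elim in auto)
    then show ?case by (simp add: h_def hn_def)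
  qed
  \<comment> \<open>The radial step 1 - r n is at most the distance from cis \<phi> to r n times a,
    so moving a inwards reduces the distance by a factor of at most 2. This is the lower half of the
    domination.\<close>
  have low: "h \<phi> \<le> hn n \<phi> + ln 2" if "cis \<phi> \<noteq> a" for n \<phi>
  proof -
    have "cmod (cis \<phi> - a) \<le> cmod (cis \<phi> - of_real (r n) * a) + cmod (of_real (r n) * a - a)"
      using norm_triangle_ineq[of "cis \<phi> - of_real (r n) * a" "of_real (r n) * a - a"] by simp
    also have "cmod (of_real (r n) * a - a) = 1 - r n"
    proof -
      have "of_real (r n) * a - a = of_real (r n - 1) * a" by (simp add: algebra_simps)
      then have "cmod (of_real (r n) * a - a) = \<bar>r n - 1\<bar>"
        using a by (simp only: norm_mult norm_of_real mult_1_right)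
      then show ?thesis using r[of n] by simp
    qed
    also have "1 - r n \<le> cmod (cis \<phi> - of_real (r n) * a)"
      using norm_triangle_ineq2[of "cis \<phi>" "of_real (r n) * a"] ra[of n] by simp
    finally have "cmod (cis \<phi> - a) \<le> cmod (cis \<phi> - of_real (r n) * a) * 2" by simp
    then have "h \<phi> \<le> ln (cmod (cis \<phi> - of_real (r n) * a) * 2)"
      unfolding h_def using that pos[of \<phi> n] by (subst ln_le_cancel_iff) auto
    also have "\<dots> = hn n \<phi> + ln 2" using pos[of \<phi> n] by (simp add: hn_def ln_mult)
    finally show ?thesis .
  qed
  have "(\<integral>\<^sup>+\<phi>. ennreal (ln 2 - h \<phi>) \<partial>circle_measure) =
      (\<integral>\<^sup>+\<phi>. liminf (\<lambda>n. ennreal (ln 2 - hn n \<phi>)) \<partial>circle_measure)"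
  proof (rule nn_integral_cong_AE)
    show "AE \<phi> in circle_measure. ennreal (ln 2 - h \<phi>) = liminf (\<lambda>n. ennreal (ln 2 - hn n \<phi>))"
      using lim
    proof eventually_elim
      case (elim \<phi>)
      then have "(\<lambda>n. ennreal (ln 2 - hn n \<phi>)) \<longlonglongrightarrow> ennreal (ln 2 - h \<phi>)"
        by (intro tendsto_intros)
      then show ?case using lim_imp_Liminf[of sequentially] by (metis trivial_limit_sequentially)
    qed
  qed
  also have "\<dots> \<le> liminf (\<lambda>n. \<integral>\<^sup>+\<phi>. ennreal (ln 2 - hn n \<phi>) \<partial>circle_measure)"
    by (rule nn_integral_liminf) measurable
  also have "(\<lambda>n. \<integral>\<^sup>+\<phi>. ennreal (ln 2 - hn n \<phi>) \<partial>circle_measure) = (\<lambda>n. ennreal (ln 2 * (2 * pi)))"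
  proof
    fix n
    have "(\<integral>\<^sup>+\<phi>. ennreal (ln 2 - hn n \<phi>) \<partial>circle_measure) =
        ennreal (LINT \<phi>|circle_measure. ln 2 - hn n \<phi>)"
      by (rule nn_integral_eq_integral) (use hn_int hn2 in auto)
    also have "(LINT \<phi>|circle_measure. ln 2 - hn n \<phi>) = ln 2 * (2 * pi)"
      using hn_int[of n] measure_circle by (subst Bochner_Integration.integral_diff) auto
    finally show "(\<integral>\<^sup>+\<phi>. ennreal (ln 2 - hn n \<phi>) \<partial>circle_measure) = ennreal (ln 2 * (2 * pi))" .
  qed
  finally have "(\<integral>\<^sup>+\<phi>. ennreal (ln 2 - h \<phi>) \<partial>circle_measure) \<le> ennreal (ln 2 * (2 * pi))"
    by (simp add: Liminf_const)
  then have "(\<integral>\<^sup>+\<phi>. ennreal (ln 2 - h \<phi>) \<partial>circle_measure) < \<infinity>"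
    by (rule order_le_less_trans) simp
  then have "integrable circle_measure (\<lambda>\<phi>. ln 2 - h \<phi>)"
    by (intro integrableI_nonneg) (use h2 in auto)
  then have "integrable circle_measure (\<lambda>\<phi>. ln 2 - (ln 2 - h \<phi>))"
    by (rule Bochner_Integration.integrable_diff[rotated]) simp
  then have int_h: "integrable circle_measure h" by simp
  have "(\<lambda>n. integral\<^sup>L circle_measure (hn n)) \<longlonglongrightarrow> integral\<^sup>L circle_measure h"
  proof (rule integral_dominated_convergence[where w = "\<lambda>\<phi>. \<bar>h \<phi>\<bar> + ln 2"])
    show "integrable circle_measure (\<lambda>\<phi>. \<bar>h \<phi>\<bar> + ln 2)" using int_h by auto
    show "AE \<phi> in circle_measure. norm (hn n \<phi>) \<le> \<bar>h \<phi>\<bar> + ln 2" for n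
      using AE_cis_neq[of a]
    proof eventually_elim
      case (elim \<phi>)
      show ?case using low[OF elim, of n] hn2[of n \<phi>] abs_ge_minus_self[of "h \<phi>"] abs_ge_self[of "h \<phi>"]
        unfolding real_norm_def abs_le_iff by linarith
    qed
  qed (use lim in auto)
  then have "integral\<^sup>L circle_measure h = 0" using hn_int(2) by (simp add: LIMSEQ_const_iff)
  with int_h show "integrable circle_measure (\<lambda>\<phi>. ln (cmod (cis \<phi> - a)))"
    "(LINT \<phi>|circle_measure. ln (cmod (cis \<phi> - a))) = 0"
    by (simp_all add: h_def[abs_def])
qed

lemma mean_log_dist:
  "integrable circle_measure (\<lambda>\<phi>. ln (cmod (cis \<phi> - a)))"
  "(LINT \<phi>|circle_measure. ln (cmod (cis \<phi> - a))) = 2 * pi * ln_max1 (cmod a)"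
  using mean_log_dist_off_circle[of a] mean_log_dist_on_circle[of a]
  by (cases "cmod a = 1"; simp add: ln_max1_def)+

lemma poly_eq_prod_roots: "poly f z = lead_coeff f * (\<Prod>\<zeta>\<in>#proots f. z - \<zeta>)" for z :: complex
proof -
  have "poly (\<Prod>x\<in>#M. [:-x, 1:]) z = (\<Prod>x\<in>#M. z - x)" for M
    by (induction M) (auto simp: left_diff_distrib)
  then show ?thesis
    using arg_cong[OF complex_poly_decompose_multiset[of f], of "\<lambda>p. poly p z"]
    by (simp only: poly_smult)
qed

text \<open>The logarithmic Mahler measure of f in terms of its roots, counted with multiplicity
  because \<open>proots\<close> is a multiset.\<close>

definition jensen :: "complex poly \<Rightarrow> real" where
  "jensen f = ln (cmod (lead_coeff f)) + (\<Sum>\<zeta>\<in>#proots f. ln_max1 (cmod \<zeta>))"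

lemma sum_ln_max1_nonneg: "(\<Sum>\<zeta>\<in>#M. ln_max1 (cmod \<zeta>)) \<ge> 0"
  by (induction M) (simp_all add: ln_max1_nonneg)

lemma jensen_formula:
  assumes f: "f \<noteq> 0"
  shows "integrable circle_measure (\<lambda>\<phi>. ln (cmod (poly f (cis \<phi>))))"
    "(LINT \<phi>|circle_measure. ln (cmod (poly f (cis \<phi>)))) = 2 * pi * jensen f"
proof -
  interpret finite_measure circle_measure by (rule finite_circle_measure)
  have sum: "integrable circle_measure (\<lambda>\<phi>. (\<Sum>\<zeta>\<in>#M. ln (cmod (cis \<phi> - \<zeta>)))) \<and>
    (LINT \<phi>|circle_measure. (\<Sum>\<zeta>\<in>#M. ln (cmod (cis \<phi> - \<zeta>)))) = 2 * pi * (\<Sum>\<zeta>\<in>#M. ln_max1 (cmod \<zeta>))" for M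
    by (induction M) (use mean_log_dist in \<open>auto simp: distrib_left\<close>)
  \<comment> \<open>At a root the convention ln 0 = 0 breaks the product rule, so the splitting
    holds almost everywhere only.\<close>
  have prod: "(AE \<phi> in circle_measure. cmod (\<Prod>\<zeta>\<in>#M. cis \<phi> - \<zeta>) > 0 \<and>
      ln (cmod (\<Prod>\<zeta>\<in>#M. cis \<phi> - \<zeta>)) = (\<Sum>\<zeta>\<in>#M. ln (cmod (cis \<phi> - \<zeta>))))" for M
  proof (induction M)
    case (add \<zeta> M)
    from add AE_cis_neq[of \<zeta>] show ?case
      by eventually_elim (simp add: norm_mult ln_mult)
  qed simp
  have ae: "AE \<phi> in circle_measure. ln (cmod (poly f (cis \<phi>))) =
      ln (cmod (lead_coeff f)) + (\<Sum>\<zeta>\<in>#proots f. ln (cmod (cis \<phi> - \<zeta>)))"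
    using prod[of "proots f"]
  proof eventually_elim
    case (elim \<phi>)
    have "ln (cmod (poly f (cis \<phi>))) =
        ln (cmod (lead_coeff f) * cmod (\<Prod>\<zeta>\<in>#proots f. cis \<phi> - \<zeta>))"
      by (simp only: poly_eq_prod_roots[of f] norm_mult)
    also have "\<dots> = ln (cmod (lead_coeff f)) + ln (cmod (\<Prod>\<zeta>\<in>#proots f. cis \<phi> - \<zeta>))"
      by (rule ln_mult_pos) (use elim f in auto)
    finally show ?case using elim by simp
  qed
  have meas: "(\<lambda>\<phi>. ln (cmod (poly f (cis \<phi>)))) \<in> borel_measurable circle_measure"
  proof -
    have "(\<lambda>\<phi>. cmod (poly f (cis \<phi>))) \<in> borel_measurable borel"
      by (intro borel_measurable_continuous_onI continuous_intros)
    then have "(\<lambda>\<phi>. ln (cmod (poly f (cis \<phi>)))) \<in> borel_measurable lborel" by simp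
    then show ?thesis by (rule measurable_restrict_space1)
  qed
  have int: "integrable circle_measure (\<lambda>\<phi>. ln (cmod (lead_coeff f)) + (\<Sum>\<zeta>\<in>#proots f. ln (cmod (cis \<phi> - \<zeta>))))"
    using sum by auto
  then show "integrable circle_measure (\<lambda>\<phi>. ln (cmod (poly f (cis \<phi>))))"
    by (subst integrable_cong_AE[OF meas _ ae]) auto
  have "(LINT \<phi>|circle_measure. ln (cmod (poly f (cis \<phi>)))) =
    (LINT \<phi>|circle_measure. ln (cmod (lead_coeff f)) + (\<Sum>\<zeta>\<in>#proots f. ln (cmod (cis \<phi> - \<zeta>))))"
    by (rule integral_cong_AE[OF meas _ ae]) (use int in auto)
  also have "\<dots> = 2 * pi * jensen f"
    using sum[of "proots f"] measure_circle by (simp add: jensen_def distrib_left)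
  finally show "(LINT \<phi>|circle_measure. ln (cmod (poly f (cis \<phi>)))) = 2 * pi * jensen f" .
qed


section \<open>Integration over the torus\<close>

definition cis_vec :: "real ^ 'v \<Rightarrow> complex ^ 'v" where
  "cis_vec \<theta> = (\<chi> v. cis (\<theta> $ v))"

text \<open>Half-open, so that every point has exactly one translate by the period lattice in it;
  the closed box would count boundary points repeatedly.\<close>

definition torus_cube :: "(real ^ 'v::finite) set" where
  "torus_cube = {\<theta>. \<forall>v. 0 \<le> \<theta> $ v \<and> \<theta> $ v < 2 * pi}"

lemma borel_torus_cube [measurable]: "torus_cube \<in> sets (borel :: (real ^ 'v::finite) measure)"
proof -
  have "torus_cube = (\<Inter>v. {\<theta> :: real ^ 'v. 0 \<le> \<theta> $ v} \<inter> {\<theta>. \<theta> $ v < 2 * pi})"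
    by (auto simp: torus_cube_def)
  also have "\<dots> \<in> sets borel"
    by (intro sets.countable_INT' sets.Int borel_closed borel_open closed_Collect_le open_Collect_less
        continuous_intros) auto
  finally show ?thesis .
qed

lemma continuous_cis_vec: "continuous_on UNIV cis_vec"
  unfolding cis_vec_def by (intro continuous_intros)

lemma measurable_cis_vec [measurable]: "cis_vec \<in> borel_measurable borel"
  by (rule borel_measurable_continuous_onI[OF continuous_cis_vec])

lemma cis_shift_2pi: "cis (t + 2 * pi * of_int k) = cis t"
  by (simp add: cis_multiple_2pi flip: cis_mult)

lemma cube_translates:
  "(\<integral>\<^sup>+k. indicator torus_cube (\<theta> + (\<chi> v. 2 * pi * of_int ((k :: int ^ 'v::finite) $ v))) \<partial>count_space UNIV) = 1"
proof -
  define k\<^sub>0 :: "int ^ 'v" where "k\<^sub>0 = (\<chi> v. - \<lfloor>\<theta> $ v / (2 * pi)\<rfloor>)"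
  have "(\<theta> + (\<chi> v. 2 * pi * of_int (k $ v)) \<in> torus_cube) = (k = k\<^sub>0)" for k :: "int ^ 'v"
  proof -
    have "(0 \<le> t + 2 * pi * of_int j \<and> t + 2 * pi * of_int j < 2 * pi) = (j = - \<lfloor>t / (2 * pi)\<rfloor>)" for t and j :: int
    proof -
      have "t + 2 * pi * of_int j = 2 * pi * (t / (2 * pi) + of_int j)" by (simp add: field_simps)
      then have "(0 \<le> t + 2 * pi * of_int j \<and> t + 2 * pi * of_int j < 2 * pi) =
          (0 \<le> t / (2 * pi) + of_int j \<and> t / (2 * pi) + of_int j < 1)"
        by (simp add: zero_le_mult_iff mult_less_cancel_left_pos[of "2 * pi" _ 1, simplified] pi_gt_zero[THEN not_le[THEN iffD2]])
      also have "\<dots> = (j = - \<lfloor>t / (2 * pi)\<rfloor>)" by linarith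
      finally show ?thesis .
    qed
    then show ?thesis by (simp add: torus_cube_def k\<^sub>0_def vec_eq_iff)
  qed
  then have "(\<lambda>k :: int ^ 'v. indicator torus_cube (\<theta> + (\<chi> v. 2 * pi * of_int (k $ v))) :: ennreal) = indicator {k\<^sub>0}"
    by (auto simp: indicator_def fun_eq_iff)
  then show ?thesis by simp
qed

lemma nn_integral_translate:
  fixes f :: "'a::euclidean_space \<Rightarrow> ennreal"
  assumes [measurable]: "f \<in> borel_measurable borel"
  shows "(\<integral>\<^sup>+x. f (c + x) \<partial>lborel) = (\<integral>\<^sup>+x. f x \<partial>lborel)"
  by (subst (2) lborel_distr_plus[of c, symmetric], subst nn_integral_distr) auto

text \<open>Both sides equal the sum over the translates of the cube by the period lattice of the integrals
  over their intersections with the shifted cube.\<close>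

lemma nn_integral_torus_shift:
  fixes G :: "complex ^ 'v::finite \<Rightarrow> ennreal"
  assumes G [measurable]: "G \<in> borel_measurable borel"
  shows "(\<integral>\<^sup>+\<theta>. G (cis_vec (\<theta> + s)) * indicator torus_cube \<theta> \<partial>lborel) =
    (\<integral>\<^sup>+\<theta>. G (cis_vec \<theta>) * indicator torus_cube \<theta> \<partial>lborel)"
proof -
  define per :: "int ^ 'v \<Rightarrow> real ^ 'v" where "per k = (\<chi> v. 2 * pi * of_int (k $ v))" for k
  have cis_per: "cis_vec (\<theta> + per k) = cis_vec \<theta>" for \<theta> k
    by (simp add: cis_vec_def per_def cis_shift_2pi)
  have one: "(\<integral>\<^sup>+k. indicator torus_cube (\<theta> + per k) \<partial>count_space UNIV) = 1" for \<theta>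
    unfolding per_def by (rule cube_translates)
  have one': "(\<integral>\<^sup>+k. indicator torus_cube (\<theta> - per k) \<partial>count_space UNIV) = 1" for \<theta>
  proof -
    have "per (- k) = - per k" for k by (simp add: per_def vec_eq_iff)
    then have "(\<integral>\<^sup>+k. indicator torus_cube (\<theta> - per k) \<partial>count_space UNIV) =
        (\<integral>\<^sup>+k. indicator torus_cube (\<theta> + per (- k)) \<partial>count_space UNIV)" by simp
    also have "\<dots> = (\<integral>\<^sup>+k. indicator torus_cube (\<theta> + per k) \<partial>count_space UNIV)"
      by (rule nn_integral_bij_count_space) (auto intro: bij_uminus)
    finally show ?thesis using one by simp
  qed
  have "(\<integral>\<^sup>+\<theta>. G (cis_vec (\<theta> + s)) * indicator torus_cube \<theta> \<partial>lborel) =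
      (\<integral>\<^sup>+\<theta>. G (cis_vec \<theta>) * indicator torus_cube (\<theta> - s) \<partial>lborel)"
    using nn_integral_translate[of "\<lambda>\<theta>. G (cis_vec \<theta>) * indicator torus_cube (\<theta> - s)" s]
    by (simp add: add.commute)
  also have "\<dots> = (\<integral>\<^sup>+\<theta>. \<integral>\<^sup>+k. G (cis_vec \<theta>) * indicator torus_cube (\<theta> - s) *
      indicator torus_cube (\<theta> + per k) \<partial>count_space UNIV \<partial>lborel)"
    by (simp add: nn_integral_cmult one)
  also have "\<dots> = (\<integral>\<^sup>+k. \<integral>\<^sup>+\<theta>. G (cis_vec \<theta>) * indicator torus_cube (\<theta> - s) *
      indicator torus_cube (\<theta> + per k) \<partial>lborel \<partial>count_space UNIV)"
    by (rule nn_integral_count_space_nn_integral) auto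
  also have "\<dots> = (\<integral>\<^sup>+k. \<integral>\<^sup>+\<theta>. G (cis_vec \<theta>) * indicator torus_cube \<theta> *
      indicator torus_cube (\<theta> - s - per k) \<partial>lborel \<partial>count_space UNIV)"
  proof (rule nn_integral_cong)
    fix k
    have "(\<integral>\<^sup>+\<theta>. G (cis_vec \<theta>) * indicator torus_cube (\<theta> - s - per k) * indicator torus_cube \<theta> \<partial>lborel) =
      (\<integral>\<^sup>+\<theta>. G (cis_vec (per k + \<theta>)) * indicator torus_cube (per k + \<theta> - s - per k) *
        indicator torus_cube (per k + \<theta>) \<partial>lborel)"
      by (rule nn_integral_translate[symmetric]) measurable
    then show "(\<integral>\<^sup>+\<theta>. G (cis_vec \<theta>) * indicator torus_cube (\<theta> - s) * indicator torus_cube (\<theta> + per k) \<partial>lborel) =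
      (\<integral>\<^sup>+\<theta>. G (cis_vec \<theta>) * indicator torus_cube \<theta> * indicator torus_cube (\<theta> - s - per k) \<partial>lborel)"
      by (simp add: add.commute[of "per k"] cis_per algebra_simps)
  qed
  also have "\<dots> = (\<integral>\<^sup>+\<theta>. \<integral>\<^sup>+k. G (cis_vec \<theta>) * indicator torus_cube \<theta> *
      indicator torus_cube (\<theta> - s - per k) \<partial>count_space UNIV \<partial>lborel)"
    by (rule nn_integral_count_space_nn_integral[symmetric]) auto
  also have "\<dots> = (\<integral>\<^sup>+\<theta>. G (cis_vec \<theta>) * indicator torus_cube \<theta> \<partial>lborel)"
    by (simp add: nn_integral_cmult one')
  finally show ?thesis .
qed

section \<open>Mahler measures as averages over fibres\<close>

abbreviation torus_measure :: "(real ^ 'v::finite) measure" where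
  "torus_measure \<equiv> restrict_space lborel torus_cube"

lemma torus_cube_subset: "torus_cube \<subseteq> cbox 0 (\<chi> v. 2 * pi)"
  by (auto simp: torus_cube_def mem_box_cart less_imp_le)

lemma finite_torus_measure: "finite_measure (torus_measure :: (real ^ 'v::finite) measure)"
proof (rule finite_measureI)
  have "emeasure lborel (torus_cube :: (real ^ 'v) set) \<le> emeasure lborel (cbox (0 :: real ^ 'v) (\<chi> v. 2 * pi))"
    by (intro emeasure_mono torus_cube_subset) auto
  also have "\<dots> < top" by (simp add: emeasure_lborel_cbox_eq)
  finally show "emeasure torus_measure (space (torus_measure :: (real ^ 'v) measure)) \<noteq> \<infinity>"
    by (simp add: emeasure_restrict_space space_restrict_space)
qed

lemma continuous_mpoly_eval:
  fixes p :: "('v::finite, complex) mpoly"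
  assumes "continuous_on S f"
  shows "continuous_on S (\<lambda>\<theta>. mpoly_eval (f \<theta>) p)"
  unfolding mpoly_eval_def by (intro continuous_intros assms)

lemma measurable_mpoly_eval [measurable]:
  "(\<lambda>c. mpoly_eval c (p :: ('v::finite, complex) mpoly)) \<in> borel_measurable borel"
  by (intro borel_measurable_continuous_onI continuous_mpoly_eval continuous_on_id)

lemma mpoly_bounded_on_torus:
  fixes p :: "('v::finite, complex) mpoly"
  obtains C where "C \<ge> C\<^sub>0" "\<And>\<theta>. ln (cmod (mpoly_eval (cis_vec \<theta>) p)) \<le> C"
proof -
  define B where "B = 1 + (\<Sum>m\<in>Poly_Mapping.keys p. cmod (Poly_Mapping.lookup p m))"
  have B: "B \<ge> 1" unfolding B_def by (simp add: sum_nonneg)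
  have "cmod (mpoly_eval (cis_vec \<theta>) p) \<le> B" for \<theta>
  proof -
    have "cmod (mpoly_eval (cis_vec \<theta>) p) \<le> (\<Sum>m\<in>Poly_Mapping.keys p.
        cmod (Poly_Mapping.lookup p m * (\<Prod>v\<in>UNIV. (cis_vec \<theta> $ v) ^ Poly_Mapping.lookup m v)))"
      unfolding mpoly_eval_def by (rule norm_sum)
    then show ?thesis by (simp add: B_def norm_mult prod_norm[symmetric] norm_power cis_vec_def)
  qed
  then have "ln (cmod (mpoly_eval (cis_vec \<theta>) p)) \<le> ln B" for \<theta>
    using B by (cases "mpoly_eval (cis_vec \<theta>) p = 0") auto
  then show thesis by (intro that[of "max C\<^sub>0 (ln B)"]) (auto intro: le_max_iff_disj[THEN iffD2])
qed

text \<open>The shift by \<phi> times g preserves the torus integral. Averaging over \<phi> and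
  exchanging the integrals leaves Jensen's formula on each fibre. Subtracting from the upper bound C
  allows the exchange for nonnegative integrands; integrability over the torus is deduced from the
  result afterwards.\<close>

lemma torus_average_fibres:
  fixes p :: "('v::finite, complex) mpoly"
  assumes C: "\<And>\<theta>. ln (cmod (mpoly_eval (cis_vec \<theta>) p)) \<le> C"
    and nz: "\<And>\<theta>. fibre (cis_vec \<theta>) g p \<noteq> 0"
  shows "ennreal (2 * pi) * (\<integral>\<^sup>+\<theta>. ennreal (C - ln (cmod (mpoly_eval (cis_vec \<theta>) p))) \<partial>torus_measure) =
    (\<integral>\<^sup>+\<theta>. ennreal (2 * pi * (C - jensen (fibre (cis_vec \<theta>) g p))) \<partial>torus_measure)"
proof -
  interpret C: finite_measure circle_measure by (rule finite_circle_measure)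
  interpret Q: finite_measure "torus_measure :: (real ^ 'v) measure" by (rule finite_torus_measure)
  interpret pair_sigma_finite circle_measure "torus_measure :: (real ^ 'v) measure" ..
  define K where "K c = ennreal (C - ln (cmod (mpoly_eval c p)))" for c
  have K [measurable]: "K \<in> borel_measurable borel" unfolding K_def by measurable
  define G :: "real ^ 'v" where "G = (\<chi> v. real (g v))"
  have shift: "(\<integral>\<^sup>+\<theta>. K (cis_vec (\<theta> + s)) \<partial>torus_measure) = (\<integral>\<^sup>+\<theta>. K (cis_vec \<theta>) \<partial>torus_measure)" for s
    by (simp add: nn_integral_restrict_space nn_integral_torus_shift)
  have id: "(\<lambda>x :: real ^ 'v. x) \<in> borel_measurable torus_measure" "(\<lambda>x. x) \<in> borel_measurable circle_measure"
    by (rule measurable_restrict_space1; simp)+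
  have [measurable]: "snd \<in> borel_measurable (circle_measure \<Otimes>\<^sub>M (torus_measure :: (real ^ 'v) measure))"
    by (rule measurable_compose[OF measurable_snd id(1)])
  have [measurable]: "fst \<in> borel_measurable (circle_measure \<Otimes>\<^sub>M (torus_measure :: (real ^ 'v) measure))"
    by (rule measurable_compose[OF measurable_fst id(2)])
  have meas: "(\<lambda>(\<phi>, \<theta>). K (cis_vec (\<theta> + \<phi> *\<^sub>R G))) \<in>
      borel_measurable (circle_measure \<Otimes>\<^sub>M (torus_measure :: (real ^ 'v) measure))"
    unfolding case_prod_beta' by measurable
  have inner: "(\<integral>\<^sup>+\<phi>. K (cis_vec (\<theta> + \<phi> *\<^sub>R G)) \<partial>circle_measure) =
      ennreal (2 * pi * (C - jensen (fibre (cis_vec \<theta>) g p)))" for \<theta>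
  proof -
    let ?f = "fibre (cis_vec \<theta>) g p"
    have pe: "poly ?f (cis \<phi>) = mpoly_eval (cis_vec (\<theta> + \<phi> *\<^sub>R G)) p" for \<phi>
    proof -
      have "(\<chi> v. cis_vec \<theta> $ v * cis \<phi> ^ g v) = cis_vec (\<theta> + \<phi> *\<^sub>R G)"
        unfolding vec_eq_iff cis_vec_def G_def by (simp only: vec_lambda_beta Complex.DeMoivre cis_mult
            vector_add_component vector_scaleR_component real_scaleR_def mult.commute[of \<phi>] simp_thms)
      then show ?thesis by (simp add: poly_fibre)
    qed
    have "(\<integral>\<^sup>+\<phi>. K (cis_vec (\<theta> + \<phi> *\<^sub>R G)) \<partial>circle_measure) =
        (\<integral>\<^sup>+\<phi>. ennreal (C - ln (cmod (poly ?f (cis \<phi>)))) \<partial>circle_measure)"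
      by (simp add: K_def pe)
    also have "\<dots> = ennreal (LINT \<phi>|circle_measure. C - ln (cmod (poly ?f (cis \<phi>))))"
    proof (rule nn_integral_eq_integral)
      show "integrable circle_measure (\<lambda>\<phi>. C - ln (cmod (poly ?f (cis \<phi>))))"
        by (rule Bochner_Integration.integrable_diff[OF _ jensen_formula(1)[OF nz]]) simp
      show "AE \<phi> in circle_measure. 0 \<le> C - ln (cmod (poly ?f (cis \<phi>)))"
        using C by (simp add: pe)
    qed
    also have "(LINT \<phi>|circle_measure. C - ln (cmod (poly ?f (cis \<phi>)))) = 2 * pi * C - 2 * pi * jensen ?f"
      using jensen_formula[OF nz, of \<theta>] measure_circle by (subst Bochner_Integration.integral_diff) auto
    finally show ?thesis by (simp add: right_diff_distrib)
  qed
  have "ennreal (2 * pi) * (\<integral>\<^sup>+\<theta>. K (cis_vec \<theta>) \<partial>torus_measure) =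
      (\<integral>\<^sup>+\<phi>. \<integral>\<^sup>+\<theta>. K (cis_vec (\<theta> + \<phi> *\<^sub>R G)) \<partial>torus_measure \<partial>circle_measure)"
    unfolding shift nn_integral_const
    by (simp add: emeasure_restrict_space space_restrict_space mult.commute)
  also have "\<dots> = (\<integral>\<^sup>+\<theta>. \<integral>\<^sup>+\<phi>. K (cis_vec (\<theta> + \<phi> *\<^sub>R G)) \<partial>circle_measure \<partial>torus_measure)"
    by (rule Fubini'[OF meas, symmetric])
  finally show ?thesis by (simp add: inner) (simp add: K_def)
qed

lemma AE_torus_cube: "AE \<theta> in lborel. (\<theta> \<in> torus_cube) = (\<theta> \<in> cbox 0 (\<chi> v. 2 * pi))"
proof -
  have "cbox 0 (\<chi> v. 2 * pi) - box 0 (\<chi> v. 2 * pi) \<in> null_sets (lborel :: (real ^ 'v) measure)"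
    using negligible_frontier_interval[of "0 :: real ^ 'v" "\<chi> v. 2 * pi"]
    by (simp add: negligible_iff_null_sets null_sets_completion_iff)
  then show ?thesis
    by (rule AE_I') (auto simp: torus_cube_def mem_box_cart less_imp_le)
qed

lemma mahler_measure_torus:
  fixes p :: "('v::finite, complex) mpoly"
  shows "mahler_measure p = 1 / (2 * pi) ^ CARD('v) *
    (LINT \<theta>|torus_measure. ln (cmod (mpoly_eval (cis_vec \<theta>) p)))"
proof -
  have "(LINT \<theta>:cbox 0 (\<chi> v. 2 * pi)|lborel. ln (cmod (mpoly_eval (\<chi> v. cis (\<theta> $ v)) p))) =
     (LINT \<theta>:torus_cube|lborel. ln (cmod (mpoly_eval (cis_vec \<theta>) p)))"
    unfolding set_lebesgue_integral_def cis_vec_def[symmetric]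
  proof (rule integral_cong_AE)
    show "AE \<theta> in lborel. indicat_real (cbox 0 (\<chi> v. 2 * pi)) \<theta> *\<^sub>R ln (cmod (mpoly_eval (cis_vec \<theta>) p)) =
      indicat_real torus_cube \<theta> *\<^sub>R ln (cmod (mpoly_eval (cis_vec \<theta>) p))"
      using AE_torus_cube by eventually_elim (auto simp: indicator_def)
  qed measurable
  then show ?thesis
    by (simp add: mahler_measure_def integral_restrict_space set_lebesgue_integral_def)
qed

lemma mahler_measure_eq_0:
  fixes p :: "('v::finite, complex) mpoly"
  assumes nz: "\<And>\<theta>. fibre (cis_vec \<theta>) g p \<noteq> 0"
    and 0: "\<And>\<theta>. jensen (fibre (cis_vec \<theta>) g p) = 0"
  shows "mahler_measure p = 0"
proof -
  interpret Q: finite_measure "torus_measure :: (real ^ 'v) measure" by (rule finite_torus_measure)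
  let ?L = "\<lambda>\<theta>. ln (cmod (mpoly_eval (cis_vec \<theta>) p))"
  obtain C where C: "C \<ge> 0" "\<And>\<theta>. ?L \<theta> \<le> C" using mpoly_bounded_on_torus[where p = p and C\<^sub>0 = 0] by metis
  let ?V = "measure torus_measure (space (torus_measure :: (real ^ 'v) measure))"
  have [measurable]: "?L \<in> borel_measurable torus_measure" by (rule measurable_restrict_space1) measurable
  have "ennreal (2 * pi) * (\<integral>\<^sup>+\<theta>. ennreal (C - ?L \<theta>) \<partial>torus_measure) = ennreal (2 * pi) * ennreal (C * ?V)"
    unfolding torus_average_fibres[OF C(2) nz]
    using C(1) by (simp add: 0 Q.emeasure_eq_measure ennreal_mult mult.assoc)
  then have eq: "(\<integral>\<^sup>+\<theta>. ennreal (C - ?L \<theta>) \<partial>torus_measure) = ennreal (C * ?V)"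
    by (simp add: ennreal_mult_cancel_left)
  have int: "integrable torus_measure (\<lambda>\<theta>. C - ?L \<theta>)"
    by (rule integrableI_nonneg) (use C eq in auto)
  have "ennreal (LINT \<theta>|torus_measure. C - ?L \<theta>) = ennreal (C * ?V)"
    unfolding eq[symmetric] by (rule nn_integral_eq_integral[symmetric]) (use int C in auto)
  then have "(LINT \<theta>|torus_measure. C - ?L \<theta>) = C * ?V"
    using C by (subst (asm) ennreal_inj) (auto intro: integral_nonneg_AE)
  moreover have "(LINT \<theta>|torus_measure. ?L \<theta>) = (LINT \<theta>|(torus_measure :: (real ^ 'v) measure). C) - (LINT \<theta>|torus_measure. C - ?L \<theta>)"
    using Bochner_Integration.integral_diff[OF _ int, of "\<lambda>_. C"] by simp
  ultimately show ?thesis by (simp add: mahler_measure_torus mult.commute)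
qed

text \<open>The average over fibres is at least \<delta> times the measure of the part of U in the
  cube, and that part has positive measure.\<close>

lemma mahler_measure_pos:
  fixes p :: "('v::finite, complex) mpoly"
  assumes nz: "\<And>\<theta>. fibre (cis_vec \<theta>) g p \<noteq> 0"
    and nonneg: "\<And>\<theta>. jensen (fibre (cis_vec \<theta>) g p) \<ge> 0"
    and U: "open U" "\<theta>\<^sub>0 \<in> U" "\<theta>\<^sub>0 \<in> torus_cube"
    and \<delta>: "\<delta> > 0" "\<And>\<theta>. \<theta> \<in> U \<Longrightarrow> jensen (fibre (cis_vec \<theta>) g p) \<ge> \<delta>"
  shows "mahler_measure p > 0"
proof -
  interpret Q: finite_measure "torus_measure :: (real ^ 'v) measure" by (rule finite_torus_measure)
  let ?L = "\<lambda>\<theta>. ln (cmod (mpoly_eval (cis_vec \<theta>) p))"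
  \<comment> \<open>A bound of at least \<delta> keeps C - \<delta> nonnegative on U, so that the
    upper estimate is again an integral of a nonnegative function.\<close>
  obtain C where C: "C \<ge> \<delta>" "\<And>\<theta>. ?L \<theta> \<le> C" using mpoly_bounded_on_torus[where p = p and C\<^sub>0 = \<delta>] by metis
  have [measurable]: "U \<in> sets borel" using U(1) by auto
  define I where "I = (LINT \<theta>|torus_measure. indicator U \<theta> :: real)"
  have intU: "integrable torus_measure (indicat_real U)"
    by (rule Q.integrable_const_bound[of _ 1]) (auto intro!: measurable_restrict_space1)
  let ?V = "measure torus_measure (space (torus_measure :: (real ^ 'v) measure))"
  have [measurable]: "?L \<in> borel_measurable torus_measure" by (rule measurable_restrict_space1) measurable
  have "ennreal (2 * pi) * (\<integral>\<^sup>+\<theta>. ennreal (C - ?L \<theta>) \<partial>torus_measure) \<le>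
      (\<integral>\<^sup>+\<theta>. ennreal (2 * pi * (C - \<delta> * indicator U \<theta>)) \<partial>torus_measure)"
    unfolding torus_average_fibres[OF C(2) nz]
    by (rule nn_integral_mono, rule ennreal_leI, rule mult_left_mono)
       (use nonneg \<delta> in \<open>auto simp: indicator_def\<close>)
  also have "\<dots> = ennreal (LINT \<theta>|torus_measure. 2 * pi * (C - \<delta> * indicator U \<theta>))"
  proof (rule nn_integral_eq_integral)
    show "integrable torus_measure (\<lambda>\<theta>. 2 * pi * (C - \<delta> * indicator U \<theta>))" using intU by simp
    show "AE \<theta> in torus_measure. 0 \<le> 2 * pi * (C - \<delta> * indicator U \<theta>)"
      using C(1) \<delta>(1) by (auto simp: indicator_def)
  qed
  also have "(LINT \<theta>|torus_measure. 2 * pi * (C - \<delta> * indicator U \<theta>)) = 2 * pi * (C * ?V - \<delta> * I)"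
    using intU by (simp add: I_def mult.commute)
  also have "ennreal (2 * pi * (C * ?V - \<delta> * I)) = ennreal (2 * pi) * ennreal (C * ?V - \<delta> * I)"
    by (rule ennreal_mult') simp
  finally have le: "(\<integral>\<^sup>+\<theta>. ennreal (C - ?L \<theta>) \<partial>torus_measure) \<le> ennreal (C * ?V - \<delta> * I)"
    by (subst (asm) ennreal_mult_le_mult_iff) auto
  have int: "integrable torus_measure (\<lambda>\<theta>. C - ?L \<theta>)"
    by (rule integrableI_nonneg) (use C order_le_less_trans[OF le] in auto)
  have "integral\<^sup>L torus_measure (indicat_real U) \<le> (LINT \<theta>|(torus_measure :: (real ^ 'v) measure). 1)"
    by (rule integral_mono) (use intU in \<open>auto simp: indicator_def\<close>)
  then have IV: "I \<le> ?V" by (simp add: I_def)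
  have "I \<ge> 0" unfolding I_def by (rule integral_nonneg_AE) auto
  then have "\<delta> * I \<le> C * ?V" using IV C(1) \<delta>(1) by (intro mult_mono) auto
  moreover have "ennreal (LINT \<theta>|torus_measure. C - ?L \<theta>) \<le> ennreal (C * ?V - \<delta> * I)"
    by (rule order_trans[OF eq_refl le], rule nn_integral_eq_integral[symmetric]) (use int C in auto)
  ultimately have "(LINT \<theta>|torus_measure. C - ?L \<theta>) \<le> C * ?V - \<delta> * I"
    by (subst (asm) ennreal_le_iff) auto
  moreover have "(LINT \<theta>|torus_measure. ?L \<theta>) = (LINT \<theta>|(torus_measure :: (real ^ 'v) measure). C) - (LINT \<theta>|torus_measure. C - ?L \<theta>)"
    using Bochner_Integration.integral_diff[OF _ int, of "\<lambda>_. C"] by simp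
  ultimately have ge: "(LINT \<theta>|torus_measure. ?L \<theta>) \<ge> \<delta> * I" by (simp add: mult.commute)
  have "I > 0"
  proof -
    \<comment> \<open>The given point may lie on a face of the cube; it is still in the closure of
      the open box, so U meets the box in a nonempty open set.\<close>
    let ?B = "box 0 (\<chi> v. 2 * pi) :: (real ^ 'v) set"
    have "(\<chi> v. pi) \<in> ?B" by (simp add: mem_box_cart)
    then have ne: "?B \<noteq> {}" by blast
    have "\<theta>\<^sub>0 \<in> closure ?B" using torus_cube_subset U(3) ne by (auto simp: closure_box)
    then have "U \<inter> ?B \<noteq> {}" using U open_Int_closure_eq_empty[of U ?B] by blast
    then have "\<not> negligible (U \<inter> ?B)" using U(1) by (intro open_not_negligible) auto
    then have "emeasure lborel (U \<inter> ?B) \<noteq> 0"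
      using U(1) by (auto simp: negligible_iff_null_sets null_sets_completion_iff null_sets_def)
    moreover have "emeasure lborel (U \<inter> ?B) \<le> emeasure lborel (U \<inter> torus_cube)"
      by (rule emeasure_mono) (auto simp: torus_cube_def mem_box_cart less_imp_le)
    moreover have "I = measure torus_measure (U \<inter> space torus_measure)"
      unfolding I_def by simp
    moreover have "emeasure torus_measure (U \<inter> space torus_measure) = emeasure lborel (U \<inter> torus_cube)"
      by (subst emeasure_restrict_space) (auto simp: space_restrict_space)
    ultimately have "ennreal I \<noteq> 0" by (auto simp: Q.emeasure_eq_measure)
    then show ?thesis using \<open>I \<ge> 0\<close> by (cases "I = 0") auto
  qed
  then have "(LINT \<theta>|torus_measure. ?L \<theta>) > 0" using ge \<delta>(1) by (smt (verit) mult_pos_pos)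
  then show ?thesis by (simp add: mahler_measure_torus)
qed


section \<open>The two cases\<close>

text \<open>The radius (|z| + 1) / 2 lies midway between 1 and |z|. If all roots were within it,
  each would be farther than (|z| - 1) / 2 from z and f z could not be small. A bound in terms of f
  z, instead of a root, persists under small changes of the fibre by continuity.\<close>

lemma jensen_lower_bound:
  assumes z: "cmod z > 1" and lc: "cmod (lead_coeff f) \<ge> 1"
    and small: "cmod (poly f z) < ((cmod z - 1) / 2) ^ degree f"
  shows "jensen f \<ge> ln ((cmod z + 1) / 2)"
proof -
  let ?\<rho> = "(cmod z - 1) / 2"
  have far: "cmod (\<Prod>\<zeta>\<in>#M. z - \<zeta>) \<ge> ?\<rho> ^ size M"
    if "\<And>\<zeta>. \<zeta> \<in># M \<Longrightarrow> cmod \<zeta> < (cmod z + 1) / 2" for M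
    using that
  proof (induction M)
    case (add \<zeta> M)
    have "cmod \<zeta> < (cmod z + 1) / 2" using add.prems by simp
    then have "?\<rho> \<le> cmod (z - \<zeta>)" using norm_triangle_ineq2[of z \<zeta>] by (simp add: field_simps)
    moreover have "?\<rho> ^ size M \<le> cmod (\<Prod>\<zeta>\<in>#M. z - \<zeta>)" using add by simp
    ultimately have "?\<rho> * ?\<rho> ^ size M \<le> cmod (z - \<zeta>) * cmod (\<Prod>\<zeta>\<in>#M. z - \<zeta>)"
      using z by (intro mult_mono) auto
    then show ?case by (simp add: norm_mult)
  qed simp
  have "\<exists>\<zeta>\<in>#proots f. cmod \<zeta> \<ge> (cmod z + 1) / 2"
  proof (rule ccontr)
    assume "\<not> ?thesis"
    then have "?\<rho> ^ size (proots f) \<le> cmod (\<Prod>\<zeta>\<in>#proots f. z - \<zeta>)" by (intro far) (simp add: not_le)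
    also have "\<dots> \<le> cmod (lead_coeff f) * cmod (\<Prod>\<zeta>\<in>#proots f. z - \<zeta>)"
      using mult_right_mono[OF lc norm_ge_zero] by simp
    also have "\<dots> = cmod (poly f z)" by (simp only: poly_eq_prod_roots[of f z] norm_mult)
    finally show False using small by (simp add: size_proots_complex)
  qed
  then obtain \<zeta> where \<zeta>: "\<zeta> \<in># proots f" "cmod \<zeta> \<ge> (cmod z + 1) / 2" by blast
  then obtain M where M: "proots f = add_mset \<zeta> M" by (metis multi_member_split)
  have "ln_max1 (cmod \<zeta>) \<ge> ln ((cmod z + 1) / 2)"
    unfolding ln_max1_def using \<zeta>(2) z by (subst ln_le_cancel_iff) auto
  moreover have "ln (cmod (lead_coeff f)) \<ge> 0" using lc by simp
  ultimately show ?thesis using sum_ln_max1_nonneg[of M] by (simp add: jensen_def M)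
qed

lemma jensen_nonneg: "cmod (lead_coeff f) \<ge> 1 \<Longrightarrow> jensen f \<ge> 0"
  by (simp add: jensen_def sum_ln_max1_nonneg)

lemma cmod_monomial_eval_cis [simp]: "cmod (monomial_eval (cis_vec \<theta>) m) = 1"
  by (simp add: monomial_eval_def prod_norm[symmetric] norm_power cis_vec_def)

lemma torus_pt_cis_vec: "torus_pt (cis_vec \<theta>)"
  by (simp add: torus_pt_def cis_vec_def)

text \<open>Separating weights have a unique monomial of largest weight, the same for every
  \<theta>, and its value on the torus has modulus 1.\<close>

lemma fibre_lead_coeff:
  fixes p :: "('v::finite, complex) mpoly"
  assumes p: "p \<noteq> 0"
    and g: "inj_on (\<lambda>m. \<Sum>v\<in>UNIV. g v * Poly_Mapping.lookup m v) (Poly_Mapping.keys p)"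
  obtains N m where "m \<in> Poly_Mapping.keys p" "\<And>\<theta>. degree (fibre (cis_vec \<theta>) g p) = N"
    "\<And>\<theta>. cmod (lead_coeff (fibre (cis_vec \<theta>) g p)) = cmod (Poly_Mapping.lookup p m)"
proof -
  let ?w = "\<lambda>m. \<Sum>v\<in>UNIV. g v * Poly_Mapping.lookup m v" and ?K = "Poly_Mapping.keys p"
  have "finite (?w ` ?K)" "?w ` ?K \<noteq> {}" using p by auto
  then have "Max (?w ` ?K) \<in> ?w ` ?K" by (rule Max_in)
  then obtain m where m: "m \<in> ?K" "Max (?w ` ?K) = ?w m" by blast
  have le: "?w n \<le> ?w m" if "n \<in> ?K" for n
    unfolding m(2)[symmetric] using that by (intro Max_ge) auto
  have c: "coeff (fibre (cis_vec \<theta>) g p) (?w m) = Poly_Mapping.lookup p m * monomial_eval (cis_vec \<theta>) m" for \<theta>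
    by (rule coeff_fibre[OF g m(1)])
  have deg: "degree (fibre (cis_vec \<theta>) g p) = ?w m" for \<theta>
  proof (rule antisym)
    show "degree (fibre (cis_vec \<theta>) g p) \<le> ?w m"
      unfolding fibre_def by (rule degree_sum_le) (auto intro: order_trans[OF degree_monom_le le])
    show "?w m \<le> degree (fibre (cis_vec \<theta>) g p)"
      by (rule le_degree) (use c m(1) monomial_eval_nz[OF torus_pt_cis_vec] in \<open>auto simp: in_keys_iff\<close>)
  qed
  show thesis
    by (rule that[OF m(1) deg]) (simp add: deg c norm_mult)
qed

lemma mahler_measure_binomial:
  fixes R :: "('v::finite, int) mpoly"
  assumes ne: "\<alpha> \<noteq> \<beta>" and K: "Poly_Mapping.keys R = {\<alpha>, \<beta>}"
    and c: "\<bar>Poly_Mapping.lookup R \<alpha>\<bar> = 1" "\<bar>Poly_Mapping.lookup R \<beta>\<bar> = 1"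
  shows "mahler_measure (mpoly_of_int R) = 0"
proof -
  let ?p = "mpoly_of_int R"
  have p: "?p \<noteq> 0" using K by (metis insert_not_empty keys_mpoly_of_int keys_zero)
  obtain g :: "'v \<Rightarrow> nat" where
    g: "inj_on (\<lambda>m. \<Sum>v\<in>UNIV. g v * Poly_Mapping.lookup m v) (Poly_Mapping.keys ?p)"
    by (rule separating_weights[OF finite_keys])
  obtain N m where m: "m \<in> Poly_Mapping.keys ?p" "\<And>\<theta>. degree (fibre (cis_vec \<theta>) g ?p) = N"
    "\<And>\<theta>. cmod (lead_coeff (fibre (cis_vec \<theta>) g ?p)) = cmod (Poly_Mapping.lookup ?p m)"
    using fibre_lead_coeff[OF p g] by metis
  have l1: "cmod (Poly_Mapping.lookup ?p n) = 1" if "n \<in> {\<alpha>, \<beta>}" for n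
    using that c by (auto simp flip: of_int_abs)
  have lc: "cmod (lead_coeff (fibre (cis_vec \<theta>) g ?p)) = 1" for \<theta>
    using m(3) l1 m(1) K by simp
  have nz: "fibre (cis_vec \<theta>) g ?p \<noteq> 0" for \<theta> using lc[of \<theta>] by auto
  let ?w = "\<lambda>m. \<Sum>v\<in>UNIV. g v * Poly_Mapping.lookup m v"
  have wne: "?w \<alpha> \<noteq> ?w \<beta>" using g ne K by (auto simp: inj_on_def)
  \<comment> \<open>A root balances the two terms, whose coefficients have modulus 1, so |z| has
    equal powers with different exponents; this excludes |z| > 1.\<close>
  have small: "cmod z \<le> 1" if z: "poly (fibre (cis_vec \<theta>) g ?p) z = 0" for \<theta> z
  proof (rule ccontr)
    assume "\<not> cmod z \<le> 1"
    then have z1: "cmod z > 1" by simp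
    define a where "a n = Poly_Mapping.lookup ?p n * monomial_eval (cis_vec \<theta>) n" for n
    have a: "cmod (a n) = 1" if "n \<in> {\<alpha>, \<beta>}" for n using l1[OF that] by (simp add: a_def norm_mult)
    have "a \<alpha> * z ^ ?w \<alpha> + a \<beta> * z ^ ?w \<beta> = 0"
      using z ne by (simp add: fibre_def K poly_sum poly_monom a_def)
    then have "a \<alpha> * z ^ ?w \<alpha> = - (a \<beta> * z ^ ?w \<beta>)" by (simp add: add_eq_0_iff2)
    then have "cmod (a \<alpha> * z ^ ?w \<alpha>) = cmod (a \<beta> * z ^ ?w \<beta>)" by simp
    then have "cmod z ^ ?w \<alpha> = cmod z ^ ?w \<beta>" using a by (simp add: norm_mult norm_power)
    then show False using wne z1 by simp
  qed
  have "jensen (fibre (cis_vec \<theta>) g ?p) = 0" for \<theta>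
  proof -
    have "ln_max1 (cmod \<zeta>) = 0" if "\<zeta> \<in># proots (fibre (cis_vec \<theta>) g ?p)" for \<zeta>
      using small[of \<theta> \<zeta>] that nz by (auto simp: ln_max1_def)
    then have "image_mset (\<lambda>\<zeta>. ln_max1 (cmod \<zeta>)) (proots (fibre (cis_vec \<theta>) g ?p)) =
        image_mset (\<lambda>\<zeta>. 0) (proots (fibre (cis_vec \<theta>) g ?p))"
      by (rule image_mset_cong)
    then show ?thesis using lc[of \<theta>] by (simp add: jensen_def)
  qed
  then show ?thesis by (rule mahler_measure_eq_0[OF nz])
qed

text \<open>Applied to u = g, the hypothesis gives a zero c of R with |c v| = z^(g v) for a real z >
  1. The phases of c form a torus point w with c = w z^g, so the fibre through w has the root z
  outside the disc.\<close>

lemma mahler_measure_pos_if_unbounded: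
  fixes R :: "('v::finite, int) mpoly" and S :: "(complex ^ 'v) set"
  assumes R: "R \<noteq> 0" and van: "\<And>c. c \<in> S \<Longrightarrow> int_eval c R = 0"
    and S: "\<And>u :: 'v \<Rightarrow> real. \<exists>e\<^sub>0>0. \<forall>e. 0 < e \<and> e < e\<^sub>0 \<longrightarrow> (\<exists>c\<in>S. \<forall>v. cmod (c $ v) = exp (e * u v))"
  shows "mahler_measure (mpoly_of_int R) > 0"
proof -
  let ?p = "mpoly_of_int R"
  have p: "?p \<noteq> 0" using R by (metis keys_mpoly_of_int keys_eq_empty)
  obtain g :: "'v \<Rightarrow> nat" where
    g: "inj_on (\<lambda>m. \<Sum>v\<in>UNIV. g v * Poly_Mapping.lookup m v) (Poly_Mapping.keys ?p)"
    by (rule separating_weights[OF finite_keys])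
  obtain N m where m: "m \<in> Poly_Mapping.keys ?p" "\<And>\<theta>. degree (fibre (cis_vec \<theta>) g ?p) = N"
    "\<And>\<theta>. cmod (lead_coeff (fibre (cis_vec \<theta>) g ?p)) = cmod (Poly_Mapping.lookup ?p m)"
    using fibre_lead_coeff[OF p g] by metis
  have "\<bar>Poly_Mapping.lookup R m\<bar> \<ge> 1" using m(1) by (simp add: in_keys_iff)
  then have "cmod (Poly_Mapping.lookup ?p m) \<ge> 1" by (simp flip: of_int_abs)
  then have lc: "cmod (lead_coeff (fibre (cis_vec \<theta>) g ?p)) \<ge> 1" for \<theta> by (simp add: m(3))
  have nz: "fibre (cis_vec \<theta>) g ?p \<noteq> 0" for \<theta> using lc[of \<theta>] by auto
  obtain e\<^sub>0 where e\<^sub>0: "e\<^sub>0 > 0" "\<And>e. 0 < e \<and> e < e\<^sub>0 \<longrightarrow> (\<exists>c\<in>S. \<forall>v. cmod (c $ v) = exp (e * real (g v)))"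
    using S[of "\<lambda>v. real (g v)"] by blast
  define e where "e = e\<^sub>0 / 2"
  have "0 < e" "e < e\<^sub>0" using e\<^sub>0(1) by (auto simp: e_def)
  then obtain c where c: "c \<in> S" "\<And>v. cmod (c $ v) = exp (e * real (g v))" using e\<^sub>0(2) by blast
  define z :: complex where "z = of_real (exp e)"
  have z: "cmod z > 1" using \<open>0 < e\<close> by (simp add: z_def)
  define \<theta>\<^sub>0 where "\<theta>\<^sub>0 = (\<chi> v. Arg2pi (c $ v))"
  have \<theta>\<^sub>0: "\<theta>\<^sub>0 \<in> torus_cube" using Arg2pi by (simp add: torus_cube_def \<theta>\<^sub>0_def)
  have "(\<chi> v. cis_vec \<theta>\<^sub>0 $ v * z ^ g v) = c"
  proof -
    have "cis (Arg2pi (c $ v)) * z ^ g v = c $ v" for v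
    proof -
      have "z ^ g v = of_real (cmod (c $ v))"
        by (simp add: z_def c(2) exp_of_nat_mult[symmetric] mult.commute flip: of_real_power)
      then show ?thesis using Arg2pi_eq[of "c $ v"] by (simp add: cis_conv_exp mult.commute)
    qed
    then show ?thesis by (simp add: vec_eq_iff cis_vec_def \<theta>\<^sub>0_def)
  qed
  then have root: "poly (fibre (cis_vec \<theta>\<^sub>0) g ?p) z = 0"
    using van[OF c(1)] by (simp add: poly_fibre int_eval_def)
  \<comment> \<open>The threshold is constant because all fibres have the same degree N; this makes
    U open.\<close>
  define U where "U = {\<theta>. cmod (poly (fibre (cis_vec \<theta>) g ?p) z) < ((cmod z - 1) / 2) ^ N}"
  show ?thesis
  proof (rule mahler_measure_pos[OF nz, of U \<theta>\<^sub>0 "ln ((cmod z + 1) / 2)"])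
    show "jensen (fibre (cis_vec \<theta>) g ?p) \<ge> 0" for \<theta> by (rule jensen_nonneg[OF lc])
    show "open U" unfolding U_def poly_fibre cis_vec_def
      by (intro open_Collect_less continuous_intros continuous_mpoly_eval)
    show "\<theta>\<^sub>0 \<in> U" using z by (simp add: U_def root)
    show "ln ((cmod z + 1) / 2) > 0" using z by simp
    show "jensen (fibre (cis_vec \<theta>) g ?p) \<ge> ln ((cmod z + 1) / 2)" if "\<theta> \<in> U" for \<theta>
      by (rule jensen_lower_bound[OF z lc]) (use that in \<open>simp add: U_def m(2)\<close>)
  qed (rule \<theta>\<^sub>0)
qed

section \<open>Newton polytopes of dimension one\<close>

definition expvec :: "('v \<Rightarrow>\<^sub>0 nat) \<Rightarrow> real ^ 'v" where
  "expvec m = (\<chi> v. real (Poly_Mapping.lookup m v))"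

lemma inj_expvec: "inj expvec"
  by (rule injI, rule poly_mapping_eqI) (simp add: expvec_def vec_eq_iff)

lemma newton_polytope_expvec: "newton_polytope p = convex hull (expvec ` Poly_Mapping.keys p)"
  by (simp add: newton_polytope_def expvec_def[abs_def])

lemma aff_dim_binomial:
  assumes "\<alpha> \<noteq> \<beta>" "Poly_Mapping.keys R = {\<alpha>, \<beta>}"
  shows "aff_dim (newton_polytope R) = 1"
  using assms injD[OF inj_expvec, of \<alpha> \<beta>]
  by (auto simp: newton_polytope_expvec aff_dim_convex_hull aff_dim_2)

text \<open>For collinear exponents R is a monomial times a univariate function of y = c^\<delta>.
  Zeros with |c v| = exp (e * \<delta> v) give |y| = exp (e * (\<delta> \<bullet> \<delta>)), a
  different modulus for every small e, whereas f has finitely many roots.\<close>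

lemma aff_dim_ne_1_if_unbounded:
  fixes R :: "('v::finite, int) mpoly" and S :: "(complex ^ 'v) set"
  assumes van: "\<And>c. c \<in> S \<Longrightarrow> int_eval c R = 0"
    and S: "\<And>u :: 'v \<Rightarrow> real. \<exists>e\<^sub>0>0. \<forall>e. 0 < e \<and> e < e\<^sub>0 \<longrightarrow> (\<exists>c\<in>S. \<forall>v. cmod (c $ v) = exp (e * u v))"
  shows "aff_dim (newton_polytope R) \<noteq> 1"
proof
  let ?K = "Poly_Mapping.keys R"
  assume "aff_dim (newton_polytope R) = 1"
  then have d: "aff_dim (expvec ` ?K) = 1" by (simp add: newton_polytope_expvec aff_dim_convex_hull)
  then have "?K \<noteq> {}" by force
  then obtain m\<^sub>0 where m\<^sub>0: "m\<^sub>0 \<in> ?K" by blast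
  have "?K \<noteq> {m\<^sub>0}" using d by force
  then obtain m\<^sub>1 where m\<^sub>1: "m\<^sub>1 \<in> ?K" "m\<^sub>1 \<noteq> m\<^sub>0" using m\<^sub>0 by blast
  define D where "D = expvec m\<^sub>1 - expvec m\<^sub>0"
  have "D \<noteq> 0" using m\<^sub>1 injD[OF inj_expvec, of m\<^sub>1 m\<^sub>0] by (auto simp: D_def)
  then obtain v\<^sub>0 where v\<^sub>0: "D $ v\<^sub>0 \<noteq> 0" by (auto simp: vec_eq_iff)
  \<comment> \<open>Normalized to have a coordinate equal to 1: the position of an exponent on the
    line is then a difference of exponents of that indeterminate, hence an integer.\<close>
  define \<delta> where "\<delta> = D /\<^sub>R (D $ v\<^sub>0)"
  have \<delta>: "\<delta> $ v\<^sub>0 = 1" "\<delta> \<noteq> 0" using v\<^sub>0 by (auto simp: \<delta>_def)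
  have line: "expvec m = expvec m\<^sub>0 + (expvec m $ v\<^sub>0 - expvec m\<^sub>0 $ v\<^sub>0) *\<^sub>R \<delta>" if m: "m \<in> ?K" for m
  proof -
    have "collinear (expvec ` ?K)" using d by (simp add: collinear_aff_dim)
    then obtain u where u: "\<And>a b. a \<in> ?K \<Longrightarrow> b \<in> ?K \<Longrightarrow> \<exists>c. expvec a - expvec b = c *\<^sub>R u"
      unfolding collinear_def by blast
    obtain c where c: "D = c *\<^sub>R u" using u[OF m\<^sub>1(1) m\<^sub>0] unfolding D_def by blast
    obtain c' where c': "expvec m - expvec m\<^sub>0 = c' *\<^sub>R u" using u[OF m m\<^sub>0] by blast
    have "c \<noteq> 0" using \<open>D \<noteq> 0\<close> c by auto
    then have eq: "expvec m - expvec m\<^sub>0 = (c' / c) *\<^sub>R D" using c c' by simp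
    then have "expvec m $ v\<^sub>0 - expvec m\<^sub>0 $ v\<^sub>0 = (c' / c) * D $ v\<^sub>0"
      by (metis vector_minus_component vector_scaleR_component real_scaleR_def)
    then have "(expvec m $ v\<^sub>0 - expvec m\<^sub>0 $ v\<^sub>0) *\<^sub>R \<delta> = (c' / c) *\<^sub>R D" using v\<^sub>0 by (simp add: \<delta>_def)
    then show ?thesis using eq by (simp add: algebra_simps)
  qed
  define f where "f = (\<Sum>m\<in>?K. monom (of_int (Poly_Mapping.lookup R m)) (Poly_Mapping.lookup m v\<^sub>0) :: complex poly)"
  have "inj_on (\<lambda>m. Poly_Mapping.lookup m v\<^sub>0) ?K"
  proof (rule inj_onI)
    fix a b assume ab: "a \<in> ?K" "b \<in> ?K" "Poly_Mapping.lookup a v\<^sub>0 = Poly_Mapping.lookup b v\<^sub>0"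
    then have "expvec a = expvec b" using line[OF ab(1)] line[OF ab(2)] by (simp add: expvec_def)
    then show "a = b" by (rule injD[OF inj_expvec])
  qed
  then have "coeff f (Poly_Mapping.lookup m\<^sub>0 v\<^sub>0) = of_int (Poly_Mapping.lookup R m\<^sub>0)"
    unfolding f_def by (rule coeff_sum_monom_inj[OF finite_keys _ m\<^sub>0])
  then have "f \<noteq> 0" using m\<^sub>0 by (auto simp: in_keys_iff)
  then have fin: "finite (cmod ` {y. poly f y = 0})" by (simp add: poly_roots_finite)
  obtain e\<^sub>0 where e\<^sub>0: "e\<^sub>0 > 0" "\<And>e. 0 < e \<and> e < e\<^sub>0 \<longrightarrow> (\<exists>c\<in>S. \<forall>v. cmod (c $ v) = exp (e * \<delta> $ v))"
    using S[of "\<lambda>v. \<delta> $ v"] by blast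
  have "exp (e * (\<delta> \<bullet> \<delta>)) \<in> cmod ` {y. poly f y = 0}" if e: "0 < e" "e < e\<^sub>0" for e
  proof -
    obtain c where c: "c \<in> S" "\<And>v. cmod (c $ v) = exp (e * \<delta> $ v)" using e\<^sub>0(2) e by blast
    define L where "L v = Ln (c $ v)" for v
    have cnz: "c $ v \<noteq> 0" for v using c(2)[of v] by auto
    have L: "exp (L v) = c $ v" "Re (L v) = e * \<delta> $ v" for v
      using cnz c(2) by (auto simp: L_def)
    \<comment> \<open>A branch of c^\<delta>, as \<delta> need not be integral; the logarithms L are
      fixed once, so all monomials use the same branch.\<close>
    define y where "y = exp (\<Sum>v\<in>UNIV. L v * of_real (\<delta> $ v))"
    have mon: "monomial_eval c m = exp (\<Sum>v\<in>UNIV. L v * of_real (expvec m $ v))" for m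
      by (simp add: monomial_eval_def exp_sum expvec_def L(1)[symmetric] exp_of_nat_mult[symmetric] mult.commute)
    \<comment> \<open>Cross-multiplied, because the difference of the two exponents of y may be
      negative.\<close>
    have "monomial_eval c m * y ^ Poly_Mapping.lookup m\<^sub>0 v\<^sub>0 =
        monomial_eval c m\<^sub>0 * y ^ Poly_Mapping.lookup m v\<^sub>0" if m: "m \<in> ?K" for m
    proof -
      let ?a = "expvec m $ v\<^sub>0" and ?b = "expvec m\<^sub>0 $ v\<^sub>0"
      have ypow: "y ^ Poly_Mapping.lookup n v\<^sub>0 = exp (of_real (expvec n $ v\<^sub>0) * (\<Sum>v\<in>UNIV. L v * of_real (\<delta> $ v)))" for n
        by (simp add: y_def expvec_def exp_of_nat_mult)
      have "(\<Sum>v\<in>UNIV. L v * of_real (expvec m $ v)) =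
          (\<Sum>v\<in>UNIV. L v * of_real (expvec m\<^sub>0 $ v) + of_real (?a - ?b) * (L v * of_real (\<delta> $ v)))"
        by (subst line[OF m]) (simp add: algebra_simps)
      also have "\<dots> = (\<Sum>v\<in>UNIV. L v * of_real (expvec m\<^sub>0 $ v)) +
          of_real (?a - ?b) * (\<Sum>v\<in>UNIV. L v * of_real (\<delta> $ v))"
        by (simp only: sum.distrib sum_distrib_left)
      finally show ?thesis
        unfolding mon ypow by (simp add: exp_add[symmetric] algebra_simps)
    qed
    then have "(\<Sum>m\<in>?K. of_int (Poly_Mapping.lookup R m) * monomial_eval c m) * y ^ Poly_Mapping.lookup m\<^sub>0 v\<^sub>0 =
        monomial_eval c m\<^sub>0 * (\<Sum>m\<in>?K. of_int (Poly_Mapping.lookup R m) * y ^ Poly_Mapping.lookup m v\<^sub>0)"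
      unfolding sum_distrib_left sum_distrib_right by (intro sum.cong) (auto simp: mult_ac)
    then have "monomial_eval c m\<^sub>0 * poly f y = 0"
      using van[OF c(1)] by (simp add: int_eval_monomials f_def poly_sum poly_monom)
    moreover have "monomial_eval c m\<^sub>0 \<noteq> 0" by (simp add: mon)
    ultimately have "poly f y = 0" by simp
    moreover have "cmod y = exp (e * (\<delta> \<bullet> \<delta>))"
      by (simp add: y_def L(2) inner_vec_def sum_distrib_left mult.assoc)
    ultimately show ?thesis by (metis (mono_tags, lifting) image_eqI mem_Collect_eq)
  qed
  then have "(\<lambda>e. exp (e * (\<delta> \<bullet> \<delta>))) ` {0<..<e\<^sub>0} \<subseteq> cmod ` {y. poly f y = 0}" by auto
  then have "finite ((\<lambda>e. exp (e * (\<delta> \<bullet> \<delta>))) ` {0<..<e\<^sub>0})" using fin by (rule finite_subset)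
  moreover have "inj_on (\<lambda>e. exp (e * (\<delta> \<bullet> \<delta>))) {0<..<e\<^sub>0}" using \<delta>(2) by (auto simp: inj_on_def)
  ultimately have "finite {0<..<e\<^sub>0}" by (rule finite_imageD)
  then show False using infinite_Ioo[OF e\<^sub>0(1)] by blast
qed

theorem theorem1:
  fixes A :: "nat \<Rightarrow> (int ^ 'n::finite) set"
    and x :: "nat \<Rightarrow> int ^ 'n \<Rightarrow> 'v::finite"
    and R :: "('v, int) mpoly"
  assumes "\<And>i. i \<le> CARD('n) \<Longrightarrow> finite (A i)"
    and "bij_betw (\<lambda>(i, a). x i a) (SIGMA i:{..CARD('n)}. A i) UNIV"
    and "essential_family A x"
    and "\<And>i. i \<le> CARD('n) \<Longrightarrow> card (A i) \<noteq> 1"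
    and "is_mixed_sparse_resultant A x R"
  shows "mahler_measure (mpoly_of_int R) = 0 \<longleftrightarrow> aff_dim (newton_polytope R) = 1"
proof -
  interpret support_family A x
    by standard (use assms in auto)
  have irr: "irreducible R" and van: "\<And>c. c \<in> solvable_systems A x \<Longrightarrow> int_eval c R = 0"
    using assms(5) by (auto simp: is_mixed_sparse_resultant_def int_eval_def)
  have hyp: "is_hypersurface (zariski_closure (solvable_systems A x))"
    using assms(3) by (simp add: essential_family_def)
  show ?thesis
  proof (cases "\<exists>\<nu>. (\<forall>l. (\<Sum>i\<in>edges. \<nu> i * (src i $ l - tgt i $ l)) = 0) \<and> (\<exists>i\<in>edges. \<nu> i \<noteq> 0)")
    case True
    then obtain \<nu> where \<nu>: "\<And>l. (\<Sum>i\<in>edges. \<nu> i * (src i $ l - tgt i $ l)) = 0" "\<exists>i\<in>edges. \<nu> i \<noteq> 0"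
      by blast
    obtain \<alpha> \<beta> where "\<alpha> \<noteq> \<beta>" "Poly_Mapping.keys R = {\<alpha>, \<beta>}"
      "\<bar>Poly_Mapping.lookup R \<alpha>\<bar> = 1" "\<bar>Poly_Mapping.lookup R \<beta>\<bar> = 1"
      by (rule resultant_of_dependent_edges[OF \<nu> hyp irr van])
    then show ?thesis using mahler_measure_binomial aff_dim_binomial by metis
  next
    case False
    then have indep: "\<forall>i\<in>edges. \<nu> i = 0"
      if "\<And>l. (\<Sum>i\<in>edges. \<nu> i * (src i $ l - tgt i $ l)) = 0" for \<nu>
      using that by blast
    have S: "\<exists>e\<^sub>0>0. \<forall>e. 0 < e \<and> e < e\<^sub>0 \<longrightarrow>
        (\<exists>c\<in>solvable_systems A x. \<forall>v. cmod (c $ v) = exp (e * u v))" for u :: "'v \<Rightarrow> real"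
      by (rule solvable_with_absolute_values) (rule indep)
    have "R \<noteq> 0" using irr by auto
    then have "mahler_measure (mpoly_of_int R) > 0"
      by (rule mahler_measure_pos_if_unbounded[OF _ van S])
    moreover have "aff_dim (newton_polytope R) \<noteq> 1"
      by (rule aff_dim_ne_1_if_unbounded[OF van S])
    ultimately show ?thesis by simp
  qed
qed

end
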